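(* Let $(X_i)_{i\in\mathbb Z}$ be a strictly stationary sequence of real-valued random variables with common marginal law $\mu$. Let $(I_k)_{k>0}$ be a sequence of intervals of $\mathbb R$ such that $\mu(I_1)>0$ and $\sum_{k>0}\mu(I_k)=\infty$. Set $B_k=\{X_k\in I_k\}$ for $k>0$ and $E_n=\sum_{k=1}^n\mu(I_k)$. (A) Assume that there exist $n_0>0$, $C>0$, $\delta>0$ and a non-increasing sequence $(\alpha_*(n))_{n\ge0}$ of reals such that for all $n\ge n_0$, $\tilde\alpha_{\infty,1}(n)\le C\alpha_*(n)$ and $\alpha_*(2n)\le(1-\delta)\alpha_*(n)$. Suppose in addition that $(\mu(I_n))_{n\ge1}$ is non-increasing, that $\mu(I_n)/\alpha_*(n)\to\infty$ as $n\to\infty$, and that $\sum_{n\ge1}\mu(I_n)/\alpha_*^{-1}(\mu(I_n))=\infty$. Then $(B_k)_{k>0}$ is a Borel-Cantelli sequence. (B1) Let $\eta(x)=x^{-1}\tilde\alpha_{\infty,1}([x])$. If $\lim_nE_n^{-1}\eta^{-1}(1/n)=0$, then $(B_k)_{k>0}$ is an $L^1$ Borel-Cantelli sequence. (B2) If there exists a sequence $(u_n)_{n>0}$ of positive reals such that $\sum_{n>0}\frac{\mu(I_n)}{E_n}u_n<\infty$ and $\sum_{n>0}\frac{\mu(I_n)}{E_n^2}\tilde\alpha_{\infty,1}^{-1}(E_nu_n/n)<\infty$, then $(B_k)_{k>0}$ is a strongly Borel-Cantelli sequence. (C) Assume that there exist $a>0$ and a constant $C$ such that $\tilde\alpha_{\infty,1}(n)\le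 Cn^{-a}$ for $n\ge1$. 1. If $\sum_{n\ge1}(\mu(I_n))^{(a+1)/a}=\infty$, $\lim_nn^a\mu(I_n)=\infty$ and $(\mu(I_n))_{n\ge1}$ is non-increasing, then $(B_k)_{k>0}$ is a Borel-Cantelli sequence. 2. If $\lim_nn^{-1/(a+1)}E_n=\infty$, then $(B_k)_{k>0}$ is an $L^1$ Borel-Cantelli sequence. 3. If $\sum_{n>0}n^{1/(a+1)}\mu(I_n)E_n^{-2}<\infty$, then $(B_k)_{k>0}$ is a strongly Borel-Cantelli sequence.
   Context: All random variables are defined on a probability space $(\Omega,\mathcal T,\mathbb P)$. For events $(B_k)_{k>0}$, write $S_n=\sum_{k=1}^n\mathbf 1_{B_k}$ and $E_n=\mathbb E(S_n)$. $(B_k)_{k>0}$ is a Borel-Cantelli sequence if $\mathbb P(\limsup_kB_k)=1$; it is an $L^1$ Borel-Cantelli sequence if $\sum_k\mathbb P(B_k)=\infty$ and $\lim_n\|S_n/E_n-1\|_1=0$; it is a strongly Borel-Cantelli sequence if $\sum_k\mathbb P(B_k)=\infty$ and $\lim_nS_n/E_n=1$ a.s. For a $\sigma$-field $\mathcal A\subset\mathcal T$ and a real random variable $X$, $\tilde\alpha(\mathcal A,X)=\sup_{t\in\mathbb R}\|\mathbb E(\mathbf 1_{X\le t}\mid\mathcal A)-\mathbb P(X\le t)\|_1$. With $\mathcal F_0=\sigma(X_k:k\le0)$, $\tilde\alpha_{\infty,1}(n)=\tilde\alpha(\mathcal F_0,X_n)$ for $n\ge0$; it is non-increasing in $n$.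 For a non-increasing sequence $(v_n)_{n\in\mathbb N}$ of reals ($\mathbb N=\{0,1,2,\dots\}$), $v^{-1}(u)=\inf\{n\in\mathbb N:v_n\le u\}$ ($=+\infty$ if the set is empty); $\alpha_*^{-1}$ and $\tilde\alpha_{\infty,1}^{-1}$ are meant in this sense. $[x]$ is the integer part of $x$, and $\eta^{-1}(u)=\inf\{x>0:\eta(x)\le u\}$ is the generalized inverse of $\eta$ on $(0,\infty)$. Conventions in (A): $\mu(I_n)/\alpha_*(n)=+\infty$ if $\alpha_*(n)=0$; terms of the series for which $\alpha_*^{-1}(\mu(I_n))=0$ are omitted. *)

theory Defs
  imports "HOL-Probability.Probability"
begin

section \<open>Borel-Cantelli sequences\<close>

text \<open>
  A sequence of events \<open>(B k)\<close>, \<open>k > 0\<close>, is a function on \<open>nat\<close> whose value at \<open>0\<close> is ignored.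
  Series over \<open>k > 0\<close> are accordingly written with \<open>Suc k\<close>.
\<close>

definition bc_count :: "(nat \<Rightarrow> 'a set) \<Rightarrow> nat \<Rightarrow> 'a \<Rightarrow> real" where
  "bc_count B n \<omega> = (\<Sum>k=1..n. indicator (B k) \<omega>)"

definition bc_mean :: "'a measure \<Rightarrow> (nat \<Rightarrow> 'a set) \<Rightarrow> nat \<Rightarrow> real" where
  "bc_mean M B n = (\<integral>\<omega>. bc_count B n \<omega> \<partial>M)"

definition borel_cantelli_seq :: "'a measure \<Rightarrow> (nat \<Rightarrow> 'a set) \<Rightarrow> bool" where
  "borel_cantelli_seq M B \<longleftrightarrow> measure M (limsup B) = 1"

text \<open>
  In the next two definitions the divergence of \<open>\<Sum>k. P(B k)\<close> makes \<open>bc_mean M B n\<close> positive for all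
  large \<open>n\<close>, so the finitely many possible divisions by zero do not affect the limits.
\<close>

definition L1_borel_cantelli_seq :: "'a measure \<Rightarrow> (nat \<Rightarrow> 'a set) \<Rightarrow> bool" where
  "L1_borel_cantelli_seq M B \<longleftrightarrow>
     \<not> summable (\<lambda>k. measure M (B (Suc k))) \<and>
     (\<lambda>n. \<integral>\<omega>. \<bar>bc_count B n \<omega> / bc_mean M B n - 1\<bar> \<partial>M) \<longlonglongrightarrow> 0"

definition strongly_borel_cantelli_seq :: "'a measure \<Rightarrow> (nat \<Rightarrow> 'a set) \<Rightarrow> bool" where
  "strongly_borel_cantelli_seq M B \<longleftrightarrow>
     \<not> summable (\<lambda>k. measure M (B (Suc k))) \<and>
     (AE \<omega> in M. (\<lambda>n. bc_count B n \<omega> / bc_mean M B n) \<longlonglongrightarrow> 1)"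

section \<open>Stationarity and dependence coefficients\<close>

definition strictly_stationary :: "'a measure \<Rightarrow> (int \<Rightarrow> 'a \<Rightarrow> real) \<Rightarrow> bool" where
  "strictly_stationary M X \<longleftrightarrow>
     (\<forall>h::int. distr M (PiM UNIV (\<lambda>_. borel)) (\<lambda>\<omega> i. X (i + h) \<omega>) =
               distr M (PiM UNIV (\<lambda>_. borel)) (\<lambda>\<omega> i. X i \<omega>))"

definition past_sigma :: "'a measure \<Rightarrow> (int \<Rightarrow> 'a \<Rightarrow> real) \<Rightarrow> 'a measure" where
  "past_sigma M X = sigma (space M) (\<Union>k\<in>{..0}. {X k -` A \<inter> space M |A. A \<in> sets borel})"

text \<open>
  A \<open>\<sigma>\<close>-field is represented by a measure \<open>F\<close> of which only the space and the measurable sets matter.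
  The supremum is over a bounded set of reals, each norm being at most \<open>1\<close>.
\<close>

definition alpha_tilde :: "'a measure \<Rightarrow> 'a measure \<Rightarrow> ('a \<Rightarrow> real) \<Rightarrow> real" where
  "alpha_tilde M F Y =
     (SUP t\<in>UNIV. \<integral>\<omega>. \<bar>real_cond_exp M F (indicator {\<omega>\<in>space M. Y \<omega> \<le> t}) \<omega>
                        - measure M {\<omega>\<in>space M. Y \<omega> \<le> t}\<bar> \<partial>M)"

definition alpha_inf1 :: "'a measure \<Rightarrow> (int \<Rightarrow> 'a \<Rightarrow> real) \<Rightarrow> nat \<Rightarrow> real" where
  "alpha_inf1 M X n = alpha_tilde M (past_sigma M X) (X (int n))"

section \<open>Generalized inverses\<close>

text \<open>In \<open>enat\<close> the infimum of the empty set is \<open>\<infinity>\<close>.\<close>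

definition seq_inverse :: "(nat \<Rightarrow> real) \<Rightarrow> real \<Rightarrow> enat" where
  "seq_inverse v u = Inf (enat ` {n. v n \<le> u})"

text \<open>
  The set below is bounded from below by \<open>0\<close>.  It is nonempty whenever \<open>f\<close> tends to \<open>0\<close> at infinity
  and \<open>u > 0\<close>, which is the only case used (\<open>f x = \<alpha> [x] / x\<close> with bounded \<open>\<alpha>\<close>).
\<close>

definition pos_inverse :: "(real \<Rightarrow> real) \<Rightarrow> real \<Rightarrow> real" where
  "pos_inverse f u = Inf {x. x > 0 \<and> f x \<le> u}"

end

theory Submission
  imports Defs
begin

text \<open>
  Everything rests on two consequences of the mixing condition.  First, for a lag \<open>q\<close> the centred
  count \<open>S\<^sub>n - E\<^sub>n\<close> splits into \<open>U + V\<close>, where \<open>U\<close> sums the differences between \<open>1\<^bsub>B k\<^esub>\<close> and its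
  conditional expectation given the past up to time \<open>k - q\<close>: terms at distance at least \<open>q\<close> are
  orthogonal, so \<open>\<parallel>U\<parallel>\<^sub>2\<close> is at most \<open>2 sqrt (q E\<^sub>n)\<close>, while \<open>\<parallel>V\<parallel>\<^sub>1\<close> is at most \<open>4 n \<alpha> q\<close>.  Optimising \<open>q\<close>
  for each \<open>n\<close> gives the \<open>L\<^sup>1\<close> statements.  For almost sure convergence it suffices to control
  \<open>S\<^sub>n / E\<^sub>n\<close> along indices \<open>N j\<close> for which \<open>E (N j)\<close> grows geometrically; as the weights
  \<open>\<mu> (I n) / E n\<close> have total mass bounded below on a geometric block, each block contains an index
  at which the error bounds are at most a constant times their weighted sum over the block, and
  these sums are summable.

  Second, if \<open>T\<close> is a set of times such that each \<open>N \<in> T\<close> is preceded by a gap \<open>g\<close> with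
  \<open>\<alpha> g \<le> \<epsilon> \<mu> (I N)\<close>, then the probability that no event occurs at times in \<open>T\<close> after \<open>K\<close> drops
  at each \<open>N \<in> T\<close> by a fixed proportion of \<open>\<mu> (I N)\<close> as long as it exceeds \<open>4 \<epsilon>\<close>.  Under the
  hypotheses of (A) such a \<open>T\<close> with \<open>\<Sum>N\<in>T. \<mu> (I N) = \<infinity>\<close> consists of arithmetic progressions in
  the dyadic blocks \<open>(2 ^ k, 2 ^ (k + 1)]\<close>, with step a multiple of \<open>\<alpha>\<^sub>*\<^sup>-\<^sup>1 (\<mu> (I (2 ^ (k + 1))))\<close>.  Blocks
  shorter than this step contribute only a geometric series to the divergent sum in (A).
\<close>

section \<open>Real sequences\<close>

text \<open>Each term from the second on is at most \<open>1 / E (k - 1) - 1 / E k\<close>, because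
  \<open>E\<close> is non-decreasing, so the series telescopes. It pays for the summand 1 in the
  weights \<open>(q n + 1) / E n\<close> of the almost sure criterion.\<close>

lemma summable_div_square_partial_sums:
  fixes m :: "nat \<Rightarrow> real"
  assumes nonneg: "\<And>k. 0 \<le> m k" and pos: "0 < m 1"
  defines "E \<equiv> \<lambda>n. \<Sum>k=1..n. m k"
  shows "summable (\<lambda>k. m (Suc k) / (E (Suc k))\<^sup>2)"
proof (rule bounded_imp_summable)
  show "0 \<le> m (Suc k) / (E (Suc k))\<^sup>2" for k using nonneg by simp
  have E_Suc: "E (Suc n) = E n + m (Suc n)" for n by (simp add: E_def)
  have E_pos: "0 < E (Suc n)" for n
    by (induction n) (use pos nonneg in \<open>auto simp: E_Suc add_pos_nonneg, simp add: E_def\<close>)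
  show "(\<Sum>k\<le>n. m (Suc k) / (E (Suc k))\<^sup>2) \<le> 2 / m 1" for n
  proof -
    \<comment> \<open>Keeping the term \<open>- 1 / E (Suc n)\<close> makes the induction close; the
      factor 2 turns the base case into an equality.\<close>
    have "(\<Sum>k\<le>n. m (Suc k) / (E (Suc k))\<^sup>2) \<le> 2 / m 1 - 1 / E (Suc n)"
    proof (induction n)
      case 0
      then show ?case using pos by (simp add: E_def power2_eq_square divide_simps)
    next
      case (Suc n)
      let ?x = "E (Suc n)" and ?y = "E (Suc (Suc n))"
      have "m (Suc (Suc n)) / ?y\<^sup>2 \<le> m (Suc (Suc n)) / (?x * ?y)"
        unfolding power2_eq_square using nonneg E_pos
        using add_pos_nonneg[OF E_pos[of n] nonneg[of "Suc (Suc n)"]]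
        by (intro divide_left_mono mult_right_mono mult_pos_pos)
          (auto simp: E_Suc[of "Suc n"] less_imp_le)
      also have "\<dots> = 1 / ?x - 1 / ?y"
        using E_pos[of n] E_pos[of "Suc n"] E_Suc[of "Suc n"] by (simp add: field_simps)
      finally show ?case using Suc by simp
    qed
    then show ?thesis using E_pos[of n] by (smt (verit) zero_less_divide_1_iff)
  qed
qed

text \<open>A weighted pigeonhole argument: on every block where \<open>E\<close> grows by the
  factor \<open>c\<close>, the weights \<open>m n / E n\<close> sum to at least a fixed \<kappa>, so
  some \<open>v n\<close> is at most \<open>1 / \<kappa>\<close> times the block's share of the
  series. The chosen index also has \<open>0 < m (N j)\<close>, since the mixing bound used later is
  available only at such indices.\<close>

lemma geometric_subsequence:
  fixes m v :: "nat \<Rightarrow> real"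
  assumes m: "\<And>k. 0 \<le> m k" "\<And>k. m k \<le> 1" and v: "\<And>k. 0 \<le> v k"
  defines "E \<equiv> \<lambda>n. \<Sum>k=1..n. m k"
  assumes lim: "filterlim E at_top sequentially"
    and summable: "summable (\<lambda>k. m (Suc k) / E (Suc k) * v (Suc k))"
    and c: "c > 1"
  obtains N J where "summable (\<lambda>j. v (N j))"
    "\<And>j. c ^ (J + j) < E (N j)" "\<And>j. E (N j) \<le> c ^ (J + j + 1)" "\<And>j. 0 < N j" "\<And>j. 0 < m (N j)"
proof -
  have E_0: "E 0 = 0" and E_Suc: "E (Suc n) = E n + m (Suc n)" for n by (simp_all add: E_def)
  have E_mono: "E i \<le> E j" if "i \<le> j" for i j
    unfolding E_def using that m by (intro sum_mono2) auto
  \<comment> \<open>\<open>f x\<close> is the first index at which \<open>E\<close> exceeds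
    \<open>x\<close>; the blocks are cut at \<open>f (c ^ (J + j))\<close>.\<close>
  define f where "f x = (LEAST n. x < E n)" for x
  have ex: "\<exists>n. x < E n" for x
    using lim unfolding filterlim_at_top_dense eventually_sequentially by blast
  have f1: "x < E (f x)" for x unfolding f_def by (rule LeastI_ex[OF ex])
  have f2: "f x \<le> n" if "x < E n" for x n unfolding f_def using that by (rule Least_le)
  have f_less: "E n \<le> x" if "n < f x" for x n using f2[of x n] that by force
  have f_ge: "x < E n" if "f x \<le> n" for x n using f1[of x] E_mono[OF that] by simp
  have f_pos: "0 < f x" if "0 \<le> x" for x
    using f1[of x] that E_0 by (metis gr0I not_less)
  have f_mono: "f x \<le> f y" if "x \<le> y" for x y using f1[of y] that by (intro f2) simp
  define w where "w n = (m n / E n) * v n" for n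
  \<comment> \<open>\<open>E\<close> can overshoot a cut by at most 1, as \<open>m\<close> is at
    most 1. Beyond \<open>c ^ J\<close> this loss is at most half of the block length
    \<open>(c - 1) * c ^ (J + j)\<close>.\<close>
  obtain J where J: "2 / (c - 1) < c ^ J"
    using real_arch_pow[OF c] by blast
  define blk where "blk j = {f (c ^ (J + j))..<f (c ^ (J + j + 1))}" for j
  have c_pow: "0 < c ^ j" for j using c by simp
  have blk_E: "c ^ (J + j) < E n" "E n \<le> c ^ (J + j + 1)" "0 < n" if "n \<in> blk j" for n j
    using that f_ge f_less f_pos[of "c ^ (J + j)"] c_pow[of "J + j"]
    unfolding blk_def by (auto simp: less_imp_le intro: less_le_trans)
  have weight: "(c - 1) * c ^ (J + j) / 2 \<le> (\<Sum>n\<in>blk j. m n)" for j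
  proof -
    let ?a = "f (c ^ (J + j))" and ?b = "f (c ^ (J + j + 1))"
    have "?a \<le> ?b" using c c_pow[of "J + j"] by (intro f_mono) simp
    have ab: "0 < ?a" using f_pos c_pow[of "J + j"] by (simp add: less_imp_le)
    have "E (?b - 1) - E (?a - 1) = (\<Sum>n\<in>blk j. m n)"
    proof -
      have "{1..?b - 1} = {1..?a - 1} \<union> blk j" "{1..?a - 1} \<inter> blk j = {}"
        using \<open>?a \<le> ?b\<close> ab unfolding blk_def by auto
      then show ?thesis unfolding E_def by (simp add: sum.union_disjoint blk_def)
    qed
    moreover have "E (?b - 1) \<ge> E ?b - 1"
      using E_Suc[of "?b - 1"] m(2)[of ?b] ab \<open>?a \<le> ?b\<close> by simp
    moreover have "E (?a - 1) \<le> c ^ (J + j)" using ab by (intro f_less) simp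
    moreover have "c ^ (J + j + 1) < E ?b" by (rule f1)
    moreover have "(c - 1) * c ^ (J + j) \<ge> 2"
    proof -
      have "c ^ J \<le> c ^ (J + j)" using c by (intro power_increasing) auto
      with J have "2 / (c - 1) < c ^ (J + j)" by simp
      then show ?thesis using c by (simp add: divide_simps mult.commute)
    qed
    ultimately show ?thesis by (simp add: algebra_simps)
  qed
  \<comment> \<open>Half of the block length divided by \<open>c ^ (J + j + 1)\<close>, the largest
    value of \<open>E\<close> on the block.\<close>
  define \<kappa> where "\<kappa> = (c - 1) / (2 * c)"
  have \<kappa>: "0 < \<kappa>" using c by (simp add: \<kappa>_def)
  have "\<exists>n\<in>blk j. 0 < m n \<and> \<kappa> * v n \<le> (\<Sum>n\<in>blk j. w n)" for j
  proof (rule ccontr)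
    assume neg: "\<not> ?thesis"
    have ratio: "\<kappa> \<le> (\<Sum>n\<in>blk j. m n / E n)"
    proof -
      have "\<kappa> = ((c - 1) * c ^ (J + j) / 2) / c ^ (J + j + 1)"
        using c by (simp add: \<kappa>_def)
      also have "\<dots> \<le> (\<Sum>n\<in>blk j. m n) / c ^ (J + j + 1)"
        using weight c by (intro divide_right_mono) auto
      also have "\<dots> = (\<Sum>n\<in>blk j. m n / c ^ (J + j + 1))" by (simp add: sum_divide_distrib)
      also have "\<dots> \<le> (\<Sum>n\<in>blk j. m n / E n)"
      proof (rule sum_mono)
        fix n assume "n \<in> blk j"
        then have "0 < E n" "E n \<le> c ^ (J + j + 1)"
          using blk_E c_pow[of "J + j"] less_trans by blast+
        then show "m n / c ^ (J + j + 1) \<le> m n / E n"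
          using m by (intro divide_left_mono) auto
      qed
      finally show ?thesis .
    qed
    let ?W = "\<Sum>n\<in>blk j. w n"
    \<comment> \<open>The minimum of \<open>v\<close> is taken over indices of positive weight only;
      the others contribute 0 to both sums compared below.\<close>
    let ?P = "{n \<in> blk j. 0 < m n}"
    have fin: "finite ?P" by (simp add: blk_def)
    have ne: "?P \<noteq> {}"
    proof
      assume "?P = {}"
      then have "m n = 0" if "n \<in> blk j" for n using that m(1)[of n] by (auto simp: less_le)
      then have "(\<Sum>n\<in>blk j. m n / E n) = 0" by (intro sum.neutral) auto
      with ratio \<kappa> show False by simp
    qed
    define v0 where "v0 = Min (v ` ?P)"
    have "v0 \<in> v ` ?P" unfolding v0_def using fin ne by (intro Min_in) auto
    then obtain n0 where n0: "n0 \<in> blk j" "0 < m n0" "v n0 = v0" by auto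
    have "\<kappa> * v0 \<le> (\<Sum>n\<in>blk j. m n / E n) * v0"
      using ratio n0 v by (intro mult_right_mono) auto
    also have "\<dots> \<le> ?W"
      unfolding sum_distrib_right w_def
    proof (rule sum_mono)
      fix n assume n: "n \<in> blk j"
      then have "0 < E n" using blk_E c_pow[of "J + j"] less_trans by blast
      moreover have "m n = 0 \<or> v0 \<le> v n"
      proof (cases "0 < m n")
        case True
        then show ?thesis unfolding v0_def using fin n by auto
      qed (use m(1)[of n] in linarith)
      ultimately show "m n / E n * v0 \<le> m n / E n * v n"
        using m(1)[of n] by (metis div_0 divide_nonneg_pos mult_left_mono mult_zero_left order_refl)
    qed
    finally show False using neg n0 by auto
  qed
  then obtain N where N: "\<And>j. N j \<in> blk j" "\<And>j. 0 < m (N j)" "\<And>j. \<kappa> * v (N j) \<le> (\<Sum>n\<in>blk j. w n)"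
    by metis
  have w_nonneg: "0 \<le> w n" for n
    unfolding w_def using m v by (auto simp: E_def intro!: mult_nonneg_nonneg divide_nonneg_nonneg sum_nonneg)
  have w_summable: "summable w"
    using summable summable_Suc_iff[of w] by (simp add: w_def)
  have "summable (\<lambda>j. \<kappa> * v (N j))"
  proof (rule bounded_imp_summable)
    show "0 \<le> \<kappa> * v (N j)" for j using \<kappa> v by simp
    show "(\<Sum>j\<le>k. \<kappa> * v (N j)) \<le> suminf w" for k
    proof -
      have "(\<Sum>j\<le>k. \<kappa> * v (N j)) \<le> (\<Sum>j\<le>k. \<Sum>n\<in>blk j. w n)" by (intro sum_mono N)
      \<comment> \<open>Consecutive blocks share their cut point, so they tile one long interval of
        indices.\<close>
      also have "\<dots> = (\<Sum>n\<in>{f (c ^ J)..<f (c ^ (J + k + 1))}. w n)"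
      proof (induction k)
        case 0
        then show ?case by (simp add: blk_def)
      next
        case (Suc k)
        have "f (c ^ J) \<le> f (c ^ (J + k + 1))" "f (c ^ (J + k + 1)) \<le> f (c ^ (J + Suc k + 1))"
          using c by (intro f_mono power_increasing; simp)+
        then show ?case using Suc by (simp add: blk_def sum.atLeastLessThan_concat)
      qed
      also have "\<dots> \<le> suminf w"
        by (intro sum_le_suminf w_summable) (auto simp: w_nonneg)
      finally show ?thesis .
    qed
  qed
  then have "summable (\<lambda>j. v (N j))" using \<kappa> by (simp add: summable_cmult_iff)
  then show thesis using blk_E[OF N(1)] N(2) by (intro that[of N J]) auto
qed

text \<open>Monotonicity interpolates between the indices \<open>N j\<close>: any large
  \<open>n\<close> lies between two of them at which \<open>E\<close> differs from
  \<open>E n\<close> by at most \<open>c\<^sup>2\<close>, and one more factor \<open>c\<close>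
  accounts for the ratio \<open>S / E\<close> there.\<close>

lemma ratio_sandwich:
  fixes E S :: "nat \<Rightarrow> real"
  assumes E: "mono E" "filterlim E at_top sequentially" and S: "mono S" and c: "c > 1"
    and N: "\<And>j. c ^ (J + j) < E (N j)" "\<And>j. E (N j) \<le> c ^ (J + j + 1)"
    and lim: "(\<lambda>j. S (N j) / E (N j)) \<longlonglongrightarrow> 1"
  shows "\<forall>\<^sub>F n in sequentially. 1 / c ^ 3 \<le> S n / E n \<and> S n / E n \<le> c ^ 3"
proof -
  have "1 / c < 1" using c by simp
  with lim have "\<forall>\<^sub>F j in sequentially. 1 / c < S (N j) / E (N j)"
    by (rule order_tendstoD)
  moreover have "\<forall>\<^sub>F j in sequentially. S (N j) / E (N j) < c"
    using lim c by (rule order_tendstoD)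
  ultimately have "\<forall>\<^sub>F j in sequentially. 1 / c < S (N j) / E (N j) \<and> S (N j) / E (N j) < c"
    by eventually_elim simp
  then obtain j0 where j0: "\<And>j. j0 \<le> j \<Longrightarrow> 1 / c < S (N j) / E (N j) \<and> S (N j) / E (N j) < c"
    unfolding eventually_sequentially by blast
  have "\<forall>\<^sub>F n in sequentially. c ^ (J + j0 + 1) < E n"
    using E(2) unfolding filterlim_at_top_dense by blast
  then show ?thesis
  proof eventually_elim
    case (elim n)
    obtain p where p: "c ^ p < E n" "E n \<le> c ^ Suc p" "J + j0 + 1 \<le> p"
    proof -
      obtain p0 where "E n < c ^ p0" using real_arch_pow[OF c] by blast
      then have ex: "\<exists>p. E n \<le> c ^ p" by (auto intro: less_imp_le)
      define q where "q = (LEAST p. E n \<le> c ^ p)"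
      have q: "E n \<le> c ^ q" unfolding q_def by (rule LeastI_ex[OF ex])
      have "J + j0 + 1 < q"
      proof (rule ccontr)
        assume "\<not> ?thesis"
        then have "c ^ q \<le> c ^ (J + j0 + 1)" using c by (intro power_increasing) auto
        with q elim show False by simp
      qed
      then obtain p where qp: "q = Suc p" by (cases q) auto
      have "\<not> E n \<le> c ^ p" unfolding q_def using not_less_Least[of p "\<lambda>p. E n \<le> c ^ p"] qp q_def by auto
      with q qp \<open>J + j0 + 1 < q\<close> show thesis by (intro that[of p]) auto
    qed
    \<comment> \<open>With this choice
      \<open>E (N a) \<le> c ^ p < E n \<le> c ^ (p + 1) < E (N (a + 2))\<close>. The step from
      \<open>a\<close> to \<open>a + 2\<close> is needed because \<open>E (N (a + 1))\<close> may
      lie on either side of \<open>E n\<close>.\<close>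
    define a where "a = p - J - 1"
    have a: "j0 \<le> a" "J + a + 1 = p" using p by (auto simp: a_def)
    let ?lo = "N a" and ?hi = "N (a + 2)"
    have cp: "0 < c ^ k" for k using c by simp
    have "E ?lo < E n" using N(2)[of a] p(1) unfolding a(2) by simp
    then have lo: "?lo \<le> n" using E(1) by (metis linorder_not_le monoD not_less_iff_gr_or_eq order_less_imp_le)
    have "c ^ Suc p < E ?hi" using N(1)[of "a + 2"] by (simp flip: a(2))
    then have "E n < E ?hi" using p by simp
    then have hi: "n \<le> ?hi" using E(1) by (metis linorder_not_le monoD order_less_imp_le)
    have En: "0 < E n" using p(1) cp[of p] by simp
    have E_lo: "0 < E ?lo" "E n \<le> c\<^sup>2 * E ?lo"
    proof -
      have *: "c ^ (J + a) < E ?lo" by (rule N(1))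
      then show "0 < E ?lo" using cp[of "J + a"] by simp
      have "E n \<le> c\<^sup>2 * c ^ (J + a)"
        using p(2) a(2) by (simp add: power_add[symmetric] power2_eq_square mult.assoc flip: a(2))
      also have "\<dots> \<le> c\<^sup>2 * E ?lo" using * by (intro mult_left_mono) auto
      finally show "E n \<le> c\<^sup>2 * E ?lo" .
    qed
    have E_hi: "0 < E ?hi" "E ?hi \<le> c\<^sup>2 * E n"
    proof -
      show "0 < E ?hi" using \<open>E n < E ?hi\<close> En by simp
      have "E ?hi \<le> c ^ (J + (a + 2) + 1)" by (rule N(2))
      also have "\<dots> = c\<^sup>2 * c ^ p" by (simp add: power2_eq_square flip: a(2))
      also have "\<dots> \<le> c\<^sup>2 * E n" using p(1) by (intro mult_left_mono) auto
      finally show "E ?hi \<le> c\<^sup>2 * E n" .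
    qed
    have "E n \<le> c ^ 3 * S n"
    proof -
      have "E ?lo \<le> c * S ?lo" using j0[OF a(1)] E_lo c by (simp add: field_simps)
      also have "\<dots> \<le> c * S n" using S lo c by (intro mult_left_mono) (auto dest: monoD)
      finally have "c\<^sup>2 * E ?lo \<le> c\<^sup>2 * (c * S n)" by (intro mult_left_mono) auto
      with E_lo show ?thesis by (simp add: power3_eq_cube power2_eq_square mult.assoc)
    qed
    moreover have "S n \<le> c ^ 3 * E n"
    proof -
      have "S n \<le> S ?hi" using S hi by (auto dest: monoD)
      also have "\<dots> \<le> c * E ?hi" using j0[of "a + 2"] a(1) E_hi by (simp add: field_simps)
      also have "\<dots> \<le> c * (c\<^sup>2 * E n)" using E_hi c by (intro mult_left_mono) auto
      finally show ?thesis by (simp add: power3_eq_cube power2_eq_square mult.assoc)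
    qed
    ultimately show ?case using En cp[of 3] by (simp add: field_simps)
  qed
qed

text \<open>Only the values \<open>c = 1 + 1 / (i + 1)\<close> occur, so that countably many
  exceptional null sets suffice when this is applied almost surely.\<close>

lemma tendsto_1_of_ratio_bounds:
  fixes r :: "nat \<Rightarrow> real"
  assumes "\<And>i. \<forall>\<^sub>F n in sequentially. 1 / (1 + 1 / real (Suc i)) ^ 3 \<le> r n \<and> r n \<le> (1 + 1 / real (Suc i)) ^ 3"
  shows "r \<longlonglongrightarrow> 1"
proof (rule order_tendstoI)
  have inv: "(\<lambda>i. 1 / real (Suc i)) \<longlonglongrightarrow> 0"
    using LIMSEQ_inverse_real_of_nat by (simp add: inverse_eq_divide)
  fix a :: real
  {
    assume a: "a < 1"
    have "(\<lambda>i. 1 / (1 + 1 / real (Suc i)) ^ 3) \<longlonglongrightarrow> 1 / (1 + 0) ^ 3"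
      by (intro tendsto_intros inv) auto
    then have "\<forall>\<^sub>F i in sequentially. a < 1 / (1 + 1 / real (Suc i)) ^ 3"
      using a by (intro order_tendstoD) auto
    then obtain i where "a < 1 / (1 + 1 / real (Suc i)) ^ 3"
      unfolding eventually_sequentially by blast
    with assms[of i] show "\<forall>\<^sub>F n in sequentially. a < r n"
      by (auto elim!: eventually_mono)
  }
  {
    assume a: "1 < a"
    have "(\<lambda>i. (1 + 1 / real (Suc i)) ^ 3) \<longlonglongrightarrow> (1 + 0) ^ 3"
      by (intro tendsto_intros inv)
    then have "\<forall>\<^sub>F i in sequentially. (1 + 1 / real (Suc i)) ^ 3 < a"
      using a by (intro order_tendstoD) auto
    then obtain i where "(1 + 1 / real (Suc i)) ^ 3 < a"
      unfolding eventually_sequentially by blast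
    with assms[of i] show "\<forall>\<^sub>F n in sequentially. r n < a"
      by (auto elim!: eventually_mono)
  }
qed

section \<open>Dyadic blocks and thinned sets of times\<close>

lemma sum_dyadic_blocks:
  fixes f :: "nat \<Rightarrow> real"
  shows "(\<Sum>k<K. \<Sum>N\<in>{2^k<..2^Suc k}. f N) = (\<Sum>N\<in>{1<..2^K}. f N)"
proof (induction K)
  case (Suc K)
  have "{1<..2^Suc K} = {1<..2^K} \<union> {2^K<..2^Suc K :: nat}"
    by (rule ivl_disj_un_two(6)[symmetric]) auto
  moreover have "{1<..2^K} \<inter> {2^K<..2^Suc K :: nat} = {}" by auto
  ultimately show ?case using Suc by (simp add: sum.union_disjoint)
qed simp

text \<open>
  \<open>T\<close> lists the progressions \<open>2 ^ k + i q k\<close> with \<open>q k \<le> 2 ^ k\<close>.  If \<open>q k > 2 ^ k\<close> then \<open>L (2 ^ (k + 1))\<close> is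
  comparable to \<open>2 ^ k\<close> or larger, so its minimality makes \<open>m (2 ^ (k + 1))\<close> decay geometrically.
\<close>

lemma thinning:
  fixes a as m :: "nat \<Rightarrow> real"
  assumes as: "antimono as" and as_nonneg: "\<And>n. 0 \<le> as n"
    and a_le: "\<And>n. n0 \<le> n \<Longrightarrow> a n \<le> C * as n"
    and halving: "\<And>n. n0 \<le> n \<Longrightarrow> as (2 * n) \<le> \<rho> * as n"
    and \<rho>: "0 < \<rho>" "\<rho> < 1" and C: "0 < C"
    and m_mono: "\<And>i j. 1 \<le> i \<Longrightarrow> i \<le> j \<Longrightarrow> m j \<le> m i"
    and m_nonneg: "\<And>n. 0 \<le> m n" and m_pos: "\<And>n. 1 \<le> n \<Longrightarrow> 0 < m n"
    and \<epsilon>: "0 < \<epsilon>"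
  defines "L \<equiv> \<lambda>n. LEAST l. 1 \<le> l \<and> as l \<le> m n"
  assumes diverges: "\<not> summable (\<lambda>n. m n / real (L n))"
  shows "\<exists>T. (\<forall>N\<in>T. 1 \<le> N) \<and>
    (\<forall>N\<in>T. \<exists>g. a g \<le> \<epsilon> * m N \<and> (\<forall>M\<in>T. M < N \<longrightarrow> M + g \<le> N)) \<and>
    \<not> summable (\<lambda>N. if N \<in> T then m N else 0)"
proof -
  have decay: "as (2 ^ j * x) \<le> \<rho> ^ j * as x" if "n0 \<le> x" for j x
  proof (induction j)
    case (Suc j)
    have "n0 \<le> 2 ^ j * x" using that by (rule order_trans) simp
    then have "as (2 * (2 ^ j * x)) \<le> \<rho> * as (2 ^ j * x)" by (rule halving)
    also have "\<dots> \<le> \<rho> * (\<rho> ^ j * as x)" using Suc \<rho> by (intro mult_left_mono) auto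
    finally show ?case by (simp add: mult.assoc)
  qed simp
  \<comment> \<open>Any exponent with \<open>n0 \<le> 2 ^ p\<close> would serve; \<open>n0\<close>
    itself is one.\<close>
  define p where "p = n0"
  have p: "n0 \<le> 2 ^ p" by (simp add: p_def less_imp_le)
  have pow_lim: "(\<lambda>j. \<rho> ^ j * c) \<longlonglongrightarrow> 0" for c
    using \<rho> by (intro tendsto_mult_left_zero LIMSEQ_realpow_zero) auto
  have pow_small: "\<exists>j. \<rho> ^ j * c < x" if "0 < x" for c x
    using order_tendstoD(2)[OF pow_lim that] unfolding eventually_sequentially by blast
  \<comment> \<open>After \<open>r\<close> doublings the decay of \<open>as\<close> outweighs the
    factor \<open>C / \<epsilon>\<close>.\<close>
  obtain r where r: "\<rho> ^ r * C < \<epsilon>" using pow_small[OF \<epsilon>] by blast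
  have L_ex: "\<exists>l\<ge>1. as l \<le> m n" if n: "1 \<le> n" for n
  proof -
    obtain j where "\<rho> ^ j * as (2 ^ p) < m n" using pow_small[OF m_pos[OF n]] by blast
    with decay[OF p, of j] have "as (2 ^ j * 2 ^ p) \<le> m n" by simp
    moreover have "(1::nat) \<le> 2 ^ j * 2 ^ p" by simp
    ultimately show ?thesis by blast
  qed
  have L: "1 \<le> L n" "as (L n) \<le> m n" if "1 \<le> n" for n
    using LeastI_ex[OF L_ex[OF that, unfolded Bex_def]] unfolding L_def by auto
  have L_le: "L n \<le> l" if "1 \<le> l" "as l \<le> m n" for n l
    unfolding L_def using that by (intro Least_le) auto
  have L_mono: "L i \<le> L j" if "1 \<le> i" "i \<le> j" for i j
    using that L[of j] m_mono[of i j] by (intro L_le) auto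
  define t where "t n = m n / real (L n)" for n
  have t_nonneg: "0 \<le> t n" for n using m_nonneg by (simp add: t_def)
  \<comment> \<open>As \<open>m\<close> decreases and \<open>L\<close> increases, \<open>t\<close>
    is non-increasing, and Cauchy condensation reduces the divergence to the dyadic indices.\<close>
  have "t (Suc n) \<le> t n" if "0 < n" for n
    unfolding t_def using that m_mono[of n "Suc n"] L_mono[of n "Suc n"] L(1)[of n] m_nonneg
    by (intro frac_le) auto
  then have "summable t \<longleftrightarrow> summable (\<lambda>n. 2 ^ n * t (2 ^ n))"
    by (intro condensation_test t_nonneg) auto
  with diverges have t_div: "\<not> summable (\<lambda>k. 2 ^ k * t (2 ^ k))" by (simp add: t_def[abs_def])
  \<comment> \<open>The factor \<open>2 ^ p\<close> moves the argument of \<open>as\<close> beyond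
    \<open>n0\<close>, where doubling is effective; \<open>2 ^ r\<close> then gains
    \<open>\<rho> ^ r\<close>.\<close>
  define Q where "Q = (2::nat) ^ (p + r)"
  have Q: "1 \<le> Q" by (simp add: Q_def)
  \<comment> \<open>\<open>L\<close> is taken at the right end of the block, where \<open>m\<close>
    is smallest, so that \<open>as (L (2 ^ Suc k)) \<le> m N\<close> for every \<open>N\<close> in
    the block.\<close>
  define q where "q k = Q * L (2 ^ Suc k)" for k
  have q_pos: "1 \<le> q k" for k
    using Q L(1)[of "2 ^ Suc k"] by (simp add: q_def del: power_Suc)
  \<comment> \<open>Starting at \<open>i = 1\<close> leaves a gap of \<open>q k\<close> after the
    left end of the block, hence also after all earlier blocks.\<close>
  define T where "T = {N. \<exists>k i. q k \<le> 2 ^ k \<and> 1 \<le> i \<and> N = 2 ^ k + i * q k \<and> N \<le> 2 ^ Suc k}"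
  define f where "f N = (if N \<in> T then m N else 0)" for N
  show ?thesis
  proof (intro exI[of _ T] conjI ballI)
    show "1 \<le> N" if "N \<in> T" for N
      using that q_pos unfolding T_def by (auto simp: Suc_le_eq)
    show "\<exists>g. a g \<le> \<epsilon> * m N \<and> (\<forall>M\<in>T. M < N \<longrightarrow> M + g \<le> N)" if "N \<in> T" for N
    proof -
      obtain k i where k: "q k \<le> 2 ^ k" "1 \<le> i" "N = 2 ^ k + i * q k" "N \<le> 2 ^ Suc k"
        using \<open>N \<in> T\<close> unfolding T_def by blast
      let ?l = "L (2 ^ Suc k)"
      have l: "1 \<le> ?l" "as ?l \<le> m (2 ^ Suc k)" by (rule L; simp)+
      have pl: "2 ^ p \<le> 2 ^ p * ?l" using l(1) by simp
      then have pl': "n0 \<le> 2 ^ p * ?l" using p by linarith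
      have q_eq: "q k = 2 ^ r * (2 ^ p * ?l)" by (simp add: q_def Q_def power_add)
      have "n0 \<le> q k" unfolding q_eq using pl' by (rule order_trans) simp
      then have "a (q k) \<le> C * as (q k)" by (rule a_le)
      also have "\<dots> \<le> C * (\<rho> ^ r * as (2 ^ p * ?l))"
        unfolding q_eq using C by (intro mult_left_mono decay pl') auto
      also have "\<dots> \<le> C * (\<rho> ^ r * as ?l)"
        using C \<rho> antimonoD[OF as, of ?l "2 ^ p * ?l"] by (intro mult_left_mono) auto
      also have "\<dots> = (\<rho> ^ r * C) * as ?l" by simp
      also have "\<dots> \<le> \<epsilon> * m N"
      proof (rule mult_mono)
        have "1 \<le> N" using k(3) by (simp add: Suc_le_eq)
        then show "as ?l \<le> m N" using l(2) m_mono[of N "2 ^ Suc k"] k(4) by simp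
      qed (use r \<epsilon> as_nonneg in auto)
      finally have 1: "a (q k) \<le> \<epsilon> * m N" .
      have 2: "M + q k \<le> N" if M: "M \<in> T" "M < N" for M
      proof -
        obtain k' i' where k': "1 \<le> i'" "M = 2 ^ k' + i' * q k'" "M \<le> 2 ^ Suc k'"
          using M(1) unfolding T_def by blast
        consider "k' = k" | "k' < k" | "k < k'" by linarith
        then show ?thesis
        proof cases
          case 1
          then have "i' * q k < i * q k" using k' k M(2) by simp
          then have "Suc i' \<le> i" by simp
          then have "Suc i' * q k \<le> i * q k" by (rule mult_le_mono1)
          then show ?thesis using 1 k' k by simp
        next
          case 2
          then have "(2::nat) ^ Suc k' \<le> 2 ^ k" by (intro power_increasing) auto
          with k'(3) have "M \<le> 2 ^ k" by (rule order_trans)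
          moreover have "q k \<le> i * q k" using k(2) by simp
          ultimately show ?thesis using k(3) by linarith
        next
          case 3
          then have "(2::nat) ^ Suc k \<le> 2 ^ k'" by (intro power_increasing) auto
          then show ?thesis using k' k M(2) by simp
        qed
      qed
      from 1 2 show ?thesis by blast
    qed
    show "\<not> summable (\<lambda>N. if N \<in> T then m N else 0)"
    proof
      assume "summable (\<lambda>N. if N \<in> T then m N else 0)"
      then have f: "summable f" by (simp add: f_def[abs_def])
      have f_nonneg: "0 \<le> f N" for N using m_nonneg by (simp add: f_def)
      define b where "b k = (\<Sum>N\<in>{2^k<..2^Suc k}. f N)" for k
      have b_nonneg: "0 \<le> b k" for k unfolding b_def by (intro sum_nonneg f_nonneg)
      have b: "summable b"
      proof (rule bounded_imp_summable[OF b_nonneg])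
        show "(\<Sum>k\<le>K. b k) \<le> suminf f" for K
          unfolding b_def lessThan_Suc_atMost[symmetric] sum_dyadic_blocks
          by (intro sum_le_suminf f) (auto simp: f_nonneg)
      qed
      \<comment> \<open>The shift makes \<open>2 ^ (j + s) = Q * (2 ^ j * 2 ^ p)\<close>, so that
        \<open>Q\<close> cancels in the case of a short block and \<open>decay\<close> applies from
        \<open>2 ^ p\<close>.\<close>
      define s where "s = p + r + p"
      have bound: "2 ^ Suc (j + s) * t (2 ^ Suc (j + s)) \<le>
          4 * real Q * b (j + s) + 2 * real Q * (\<rho> ^ j * as (2 ^ p))" for j
      proof -
        let ?k = "j + s"
        let ?n = "2 ^ Suc ?k :: nat"
        have n: "1 \<le> ?n" by simp
        have Lpos: "0 < real (L ?n)" using L(1)[OF n] by simp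
        show ?thesis
        proof (cases "q ?k \<le> 2 ^ ?k")
          case True
          let ?d = "2 ^ ?k div q ?k"
          let ?g = "\<lambda>i. 2 ^ ?k + i * q ?k"
          have "real ?d * m ?n = (\<Sum>i\<in>{1..?d}. m ?n)" by simp
          also have "\<dots> \<le> (\<Sum>i\<in>{1..?d}. f (?g i))"
          proof (rule sum_mono)
            fix i assume i: "i \<in> {1..?d}"
            then have "i * q ?k \<le> ?d * q ?k" by (intro mult_le_mono1) auto
            also have "\<dots> \<le> 2 ^ ?k" by (rule div_times_less_eq_dividend)
            finally have le: "?g i \<le> ?n" by simp
            have "?g i \<in> T"
              unfolding T_def mem_Collect_eq by (intro exI[of _ ?k] exI[of _ i]) (use True i le in simp)
            moreover have "m ?n \<le> m (?g i)"
              using le by (intro m_mono) (simp_all add: Suc_le_eq)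
            ultimately show "m ?n \<le> f (?g i)" by (simp add: f_def)
          qed
          also have "\<dots> = (\<Sum>N\<in>?g ` {1..?d}. f N)"
            using q_pos[of ?k] by (subst sum.reindex) (auto simp: inj_on_def)
          also have "\<dots> \<le> b ?k"
            unfolding b_def
          proof (rule sum_mono2)
            show "?g ` {1..?d} \<subseteq> {2 ^ ?k<..?n}"
            proof safe
              fix i assume i: "i \<in> {1..?d}"
              then have "i * q ?k \<le> ?d * q ?k" by (intro mult_le_mono1) auto
              also have "\<dots> \<le> 2 ^ ?k" by (rule div_times_less_eq_dividend)
              finally have "?g i \<le> ?n" by simp
              moreover have "0 < i * q ?k" using i q_pos[of ?k] by simp
              ultimately show "?g i \<in> {2 ^ ?k<..?n}" by simp
            qed
          qed (auto simp: f_nonneg)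
          finally have *: "real ?d * m ?n \<le> b ?k" .
          \<comment> \<open>At least one step fits into the block, so rounding down the number of
            steps loses at most a factor 2.\<close>
          have "2 ^ ?k < 2 * ?d * q ?k"
          proof -
            have "2 ^ ?k = ?d * q ?k + 2 ^ ?k mod q ?k" by (rule div_mult_mod_eq[symmetric])
            moreover have "2 ^ ?k mod q ?k < q ?k" by (rule mod_less_divisor) (use q_pos[of ?k] in simp)
            moreover have "1 \<le> ?d" using True q_pos[of ?k] by (simp add: div_greater_zero_iff Suc_le_eq)
            then have "q ?k \<le> ?d * q ?k" by simp
            ultimately show ?thesis by linarith
          qed
          then have "real (2 ^ ?k) < real (2 * ?d * q ?k)" by (simp only: of_nat_less_iff)
          then have d: "2 ^ ?k \<le> 2 * real ?d * (real Q * real (L ?n))"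
            by (simp add: q_def)
          have "2 ^ Suc ?k * t ?n = 2 * 2 ^ ?k * m ?n / real (L ?n)" by (simp add: t_def)
          also have "\<dots> \<le> 2 * (2 * real ?d * (real Q * real (L ?n))) * m ?n / real (L ?n)"
            using d m_nonneg by (intro divide_right_mono mult_right_mono mult_left_mono) auto
          also have "\<dots> = 4 * real Q * (real ?d * m ?n)" using Lpos by simp
          also have "\<dots> \<le> 4 * real Q * b ?k" using * by (intro mult_left_mono) auto
          finally have "2 ^ Suc ?k * t ?n \<le> 4 * real Q * b ?k" .
          moreover have "0 \<le> 2 * real Q * (\<rho> ^ j * as (2 ^ p))" using \<rho> as_nonneg by simp
          ultimately show ?thesis by linarith
        next
          \<comment> \<open>Here \<open>L\<close> exceeds \<open>2 ^ j * 2 ^ p\<close>; by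
            minimality of \<open>L\<close> this argument does not qualify, which makes
            \<open>m\<close> smaller than a geometrically decaying value of
            \<open>as\<close>.\<close>
          case False
          then have big: "2 ^ ?k < Q * L ?n" by (simp add: q_def)
          have "2 ^ ?k = Q * (2 ^ j * 2 ^ p)"
            by (simp add: s_def Q_def power_add ac_simps)
          with big have "2 ^ j * 2 ^ p < L ?n" by simp
          then have "\<not> as (2 ^ j * 2 ^ p) \<le> m ?n"
            using L_le[of "2 ^ j * 2 ^ p" ?n] by force
          then have small: "m ?n \<le> \<rho> ^ j * as (2 ^ p)" using decay[OF p, of j] by simp
          have "real (2 ^ ?k) < real (Q * L ?n)" using big by (simp only: of_nat_less_iff)
          then have *: "2 ^ ?k \<le> real Q * real (L ?n)" by simp
          have "2 ^ Suc ?k * t ?n = 2 * 2 ^ ?k * m ?n / real (L ?n)" by (simp add: t_def)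
          also have "\<dots> \<le> 2 * (real Q * real (L ?n)) * m ?n / real (L ?n)"
            using * m_nonneg by (intro divide_right_mono mult_right_mono mult_left_mono) auto
          also have "\<dots> = 2 * real Q * m ?n" using Lpos by simp
          also have "\<dots> \<le> 2 * real Q * (\<rho> ^ j * as (2 ^ p))" using small by (intro mult_left_mono) auto
          finally have "2 ^ Suc ?k * t ?n \<le> 2 * real Q * (\<rho> ^ j * as (2 ^ p))" .
          moreover have "0 \<le> 4 * real Q * b ?k" using b_nonneg by simp
          ultimately show ?thesis by linarith
        qed
      qed
      have "summable (\<lambda>j. 4 * real Q * b (j + s) + 2 * real Q * (\<rho> ^ j * as (2 ^ p)))"
        using b \<rho> by (intro summable_add summable_mult summable_mult2 summable_geometric)
          (auto simp: summable_iff_shift)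
      then have "summable (\<lambda>j. 2 ^ Suc (j + s) * t (2 ^ Suc (j + s)))"
        by (rule summable_comparison_test'[where N = 0])
          (use bound t_nonneg in \<open>auto simp: abs_of_nonneg\<close>)
      then have "summable (\<lambda>j. 2 ^ (j + Suc s) * t (2 ^ (j + Suc s)))" by simp
      then show False using t_div summable_iff_shift[of "\<lambda>k. 2 ^ k * t (2 ^ k)" "Suc s"] by blast
    qed
  qed
qed

section \<open>Mixing for stationary sequences\<close>

abbreviation seq_space :: "(int \<Rightarrow> real) measure" where
  "seq_space \<equiv> PiM UNIV (\<lambda>_. borel)"

abbreviation (input) coord :: "int \<Rightarrow> (int \<Rightarrow> real) \<Rightarrow> real" where
  "coord \<equiv> \<lambda>i x. x i"

lemma space_past_sigma [simp]: "space (past_sigma M Z) = space M"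
  unfolding past_sigma_def by (rule space_measure_of) auto

lemma sets_past_sigma:
  "sets (past_sigma M Z) =
     sigma_sets (space M) (\<Union>k\<in>{..0}. {Z k -` A \<inter> space M |A. A \<in> sets borel})"
  unfolding past_sigma_def by (rule sets_measure_of) auto

lemma sets_past_sigma_subset:
  assumes "\<And>i. Z i \<in> borel_measurable M"
  shows "sets (past_sigma M Z) \<subseteq> sets M"
  unfolding sets_past_sigma
  by (rule sets.sigma_sets_subset) (use assms in \<open>auto intro: measurable_sets\<close>)

lemma measurable_past_sigma:
  assumes "k \<le> 0"
  shows "Z k \<in> borel_measurable (past_sigma M Z)"
proof (rule measurableI)
  fix A :: "real set" assume "A \<in> sets borel"
  then show "Z k -` A \<inter> space (past_sigma M Z) \<in> sets (past_sigma M Z)"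
    unfolding space_past_sigma sets_past_sigma using assms by (intro sigma_sets.Basic) auto
qed simp

text \<open>Generating a \<sigma>-field commutes with taking preimages, here under the path map.
  Past events thus become events of the sequence space, where stationarity is an equality of
  laws.\<close>

lemma sets_past_sigma_vimage:
  "sets (past_sigma M Z) =
     {(\<lambda>\<omega> i. Z i \<omega>) -` A \<inter> space M |A. A \<in> sets (past_sigma seq_space coord)}"
proof -
  let ?\<Phi> = "\<lambda>\<omega> i. Z i \<omega>"
  let ?G = "\<Union>k\<in>{..0}. {coord k -` A \<inter> UNIV |A. A \<in> sets borel}"
  have sp: "space seq_space = UNIV"
    by (simp add: space_PiM)
  have "{?\<Phi> -` A \<inter> space M |A. A \<in> sigma_sets UNIV ?G} =
      sigma_sets (space M) {?\<Phi> -` A \<inter> space M |A. A \<in> ?G}"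
    by (rule sigma_sets_vimage_commute) simp
  also have "{?\<Phi> -` A \<inter> space M |A. A \<in> ?G} =
      (\<Union>k\<in>{..0}. {Z k -` A \<inter> space M |A. A \<in> sets borel})"
  proof (intro equalityI subsetI)
    fix x assume "x \<in> {?\<Phi> -` A \<inter> space M |A. A \<in> ?G}"
    then obtain k A where k: "k \<le> 0" "A \<in> sets borel"
      and x: "x = ?\<Phi> -` (coord k -` A \<inter> UNIV) \<inter> space M" by auto
    have "x = Z k -` A \<inter> space M" using x by auto
    with k show "x \<in> (\<Union>k\<in>{..0}. {Z k -` A \<inter> space M |A. A \<in> sets borel})" by blast
  next
    fix x assume "x \<in> (\<Union>k\<in>{..0}. {Z k -` A \<inter> space M |A. A \<in> sets borel})"
    then obtain k A where k: "k \<le> 0" "A \<in> sets borel" and x: "x = Z k -` A \<inter> space M"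
      by auto
    have "coord k -` A \<inter> UNIV \<in> ?G" using k by blast
    moreover have "x = ?\<Phi> -` (coord k -` A \<inter> UNIV) \<inter> space M" using x by auto
    ultimately show "x \<in> {?\<Phi> -` A \<inter> space M |A. A \<in> ?G}" by blast
  qed
  finally show ?thesis
    unfolding sets_past_sigma sp by (rule sym)
qed

section \<open>Stationary sequences and their shifted pasts\<close>

locale stationary_sequence = prob_space M for M :: "'a measure" +
  fixes X :: "int \<Rightarrow> 'a \<Rightarrow> real"
  assumes X_meas [measurable]: "\<And>i. X i \<in> borel_measurable M"
    and stationary: "strictly_stationary M X"
begin

text \<open>The \<sigma>-field generated by all \<open>X j\<close> with \<open>j \<le> m\<close>.
  Writing it as the past of the shifted sequence lets one description of \<open>past_sigma\<close>
  serve every \<open>m\<close>.\<close>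

definition past :: "int \<Rightarrow> 'a measure" where
  "past m = past_sigma M (\<lambda>i. X (i + m))"

definition marginal :: "real set \<Rightarrow> real" where
  "marginal J = prob {\<omega> \<in> space M. X 0 \<omega> \<in> J}"

abbreviation \<alpha> :: "nat \<Rightarrow> real" where
  "\<alpha> \<equiv> alpha_inf1 M X"

lemma past_0: "past 0 = past_sigma M X"
  by (simp add: past_def)

lemma space_past [simp]: "space (past m) = space M"
  by (simp add: past_def)

lemma sets_past_subset: "sets (past m) \<subseteq> sets M"
  unfolding past_def by (rule sets_past_sigma_subset) simp

lemma sets_past_mono:
  assumes "m \<le> m'"
  shows "sets (past m) \<subseteq> sets (past m')"
  unfolding past_def sets_past_sigma
proof (rule sigma_sets_mono', safe)
  fix k :: int and A :: "real set" assume k: "k \<le> 0" "A \<in> sets borel"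
  have "X (k + m) -` A \<inter> space M = X ((k + m - m') + m') -` A \<inter> space M" by simp
  moreover have "k + m - m' \<le> 0" using k assms by simp
  ultimately show "X (k + m) -` A \<inter> space M
      \<in> (\<Union>k\<in>{..0}. {X (k + m') -` A \<inter> space M |A. A \<in> sets borel})"
    using k(2) by blast
qed

lemma X_past:
  assumes "j \<le> m"
  shows "X j \<in> borel_measurable (past m)"
  using measurable_past_sigma[of "j - m" "\<lambda>i. X (i + m)" M] assms by (simp add: past_def)

lemma shift_measurable: "(\<lambda>\<omega> i. X (i + h) \<omega>) \<in> measurable M seq_space"
  by (rule measurable_PiM_single') (auto simp: space_PiM)

text \<open>The coefficient \<alpha> only refers to the past of time 0. An event of the past of
  \<open>m\<close> is the preimage of some \<open>A'\<close> under the path shifted by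
  \<open>m\<close>; its preimage under the unshifted path is \<open>A0\<close>, and the two paths
  have the same law.\<close>

lemma past_transfer:
  assumes "A \<in> sets (past m)"
  obtains A0 where "A0 \<in> sets (past 0)"
    "\<And>n J. J \<in> sets borel \<Longrightarrow>
      prob (A0 \<inter> {\<omega> \<in> space M. X n \<omega> \<in> J}) = prob (A \<inter> {\<omega> \<in> space M. X (n + m) \<omega> \<in> J})"
proof -
  let ?P = "past_sigma seq_space coord"
  obtain A' where A': "A' \<in> sets ?P" and A: "A = (\<lambda>\<omega> i. X (i + m) \<omega>) -` A' \<inter> space M"
    using assms sets_past_sigma_vimage[of M "\<lambda>i. X (i + m)"] unfolding past_def by auto
  let ?A0 = "(\<lambda>\<omega> i. X i \<omega>) -` A' \<inter> space M"
  have A'_sets [measurable]: "A' \<in> sets seq_space"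
    using sets_past_sigma_subset[of coord seq_space] A' by auto
  show thesis
  proof
    show "?A0 \<in> sets (past 0)"
      unfolding past_0 sets_past_sigma_vimage[of M X] using A' by auto
    fix n and J :: "real set" assume J [measurable]: "J \<in> sets borel"
    let ?S = "A' \<inter> {x. x n \<in> J}"
    have sp: "space seq_space = UNIV" by (simp add: space_PiM)
    have "(\<lambda>x. x n) -` J \<inter> space seq_space \<in> sets seq_space"
      by measurable
    then have S: "?S \<in> sets seq_space"
      unfolding sp by (simp add: vimage_def)
    have *: "measure (distr M seq_space (\<lambda>\<omega> i. X (i + h) \<omega>)) ?S =
        prob ((\<lambda>\<omega> i. X (i + h) \<omega>) -` ?S \<inter> space M)" for h
      by (rule measure_distr[OF shift_measurable S])
    have "distr M seq_space (\<lambda>\<omega> i. X (i + m) \<omega>) = distr M seq_space (\<lambda>\<omega> i. X (i + 0) \<omega>)"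
      using stationary unfolding strictly_stationary_def by simp
    then have "prob ((\<lambda>\<omega> i. X (i + 0) \<omega>) -` ?S \<inter> space M) =
        prob ((\<lambda>\<omega> i. X (i + m) \<omega>) -` ?S \<inter> space M)"
      by (metis *)
    moreover have "(\<lambda>\<omega> i. X (i + 0) \<omega>) -` ?S \<inter> space M =
        ?A0 \<inter> {\<omega> \<in> space M. X n \<omega> \<in> J}"
      by auto
    moreover have "(\<lambda>\<omega> i. X (i + m) \<omega>) -` ?S \<inter> space M =
        A \<inter> {\<omega> \<in> space M. X (n + m) \<omega> \<in> J}"
      by (auto simp: A)
    ultimately show "prob (?A0 \<inter> {\<omega> \<in> space M. X n \<omega> \<in> J}) =
        prob (A \<inter> {\<omega> \<in> space M. X (n + m) \<omega> \<in> J})"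
      by simp
  qed
qed

lemma prob_X:
  assumes [measurable]: "J \<in> sets borel"
  shows "prob {\<omega> \<in> space M. X k \<omega> \<in> J} = marginal J"
proof -
  have "(\<lambda>x. x 0) -` J \<inter> space seq_space \<in> sets seq_space"
    by measurable
  then have S: "{x. x 0 \<in> J} \<in> sets seq_space"
    by (simp add: vimage_def space_PiM)
  have *: "measure (distr M seq_space (\<lambda>\<omega> i. X (i + h) \<omega>)) {x. x 0 \<in> J} =
      prob ((\<lambda>\<omega> i. X (i + h) \<omega>) -` {x. x 0 \<in> J} \<inter> space M)" for h
    by (rule measure_distr[OF shift_measurable S])
  have "distr M seq_space (\<lambda>\<omega> i. X (i + k) \<omega>) = distr M seq_space (\<lambda>\<omega> i. X (i + 0) \<omega>)"
    using stationary unfolding strictly_stationary_def by simp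
  then have "prob ((\<lambda>\<omega> i. X (i + k) \<omega>) -` {x. x 0 \<in> J} \<inter> space M) =
      prob ((\<lambda>\<omega> i. X (i + 0) \<omega>) -` {x. x 0 \<in> J} \<inter> space M)"
    by (metis *)
  then show ?thesis
    unfolding marginal_def by (simp add: vimage_def Int_def conj_commute)
qed

section \<open>Conditional expectations given the past and the range of \<alpha>\<close>

lemma subalgebra_past: "subalgebra M (past m)"
  unfolding subalgebra_def using sets_past_subset by simp

lemma finite_subalgebra_past: "finite_measure_subalgebra M (past m)"
  by (simp add: finite_measure_subalgebra.intro finite_measure_subalgebra_axioms.intro
      finite_measure_axioms subalgebra_past)

lemma cond_exp_indicator:
  fixes m :: int
  assumes [measurable]: "B \<in> sets M"
  defines "Y \<equiv> real_cond_exp M (past m) (indicator B)"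
  shows "AE \<omega> in M. 0 \<le> Y \<omega> \<and> Y \<omega> \<le> 1" "integrable M Y" "expectation Y = prob B"
    "A \<in> sets (past m) \<Longrightarrow> (\<integral>\<omega>. indicator A \<omega> * Y \<omega> \<partial>M) = prob (A \<inter> B)"
proof -
  interpret S: finite_measure_subalgebra M "past m" by (rule finite_subalgebra_past)
  have int: "integrable M (indicator B :: 'a \<Rightarrow> real)" by (simp add: emeasure_eq_measure)
  show "AE \<omega> in M. 0 \<le> Y \<omega> \<and> Y \<omega> \<le> 1"
    unfolding Y_def
    using S.real_cond_exp_ge_c[OF int, of 0] S.real_cond_exp_le_c[OF int, of 1] by auto
  show "integrable M Y" "expectation Y = prob B"
    unfolding Y_def using S.real_cond_exp_int[OF int] by auto
  assume A: "A \<in> sets (past m)"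
  then have [measurable]: "A \<in> sets M" using sets_past_subset by blast
  have "(\<integral>\<omega>. indicator A \<omega> * Y \<omega> \<partial>M) = (\<integral>\<omega>. indicator A \<omega> * indicator B \<omega> \<partial>M)"
    unfolding Y_def
    by (rule S.real_cond_exp_intg(2))
       (use A in \<open>auto simp: indicator_inter_arith[symmetric] emeasure_eq_measure\<close>)
  then show "(\<integral>\<omega>. indicator A \<omega> * Y \<omega> \<partial>M) = prob (A \<inter> B)"
    by (simp add: indicator_inter_arith[symmetric])
qed

text \<open>This bound makes the real-valued supremum in \<open>alpha_tilde\<close> an actual upper
  bound of its terms.\<close>

lemma alpha_term_le_1:
  "(\<integral>\<omega>. \<bar>real_cond_exp M (past 0) (indicator {\<omega>\<in>space M. X (int n) \<omega> \<le> t}) \<omega>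
     - prob {\<omega>\<in>space M. X (int n) \<omega> \<le> t}\<bar> \<partial>M) \<le> 1"
proof -
  let ?B = "{\<omega>\<in>space M. X (int n) \<omega> \<le> t}"
  have B: "?B \<in> sets M" by measurable
  note ce = cond_exp_indicator[OF B, where m = 0]
  have "(\<integral>\<omega>. \<bar>real_cond_exp M (past 0) (indicator ?B) \<omega> - prob ?B\<bar> \<partial>M) \<le> (\<integral>\<omega>. 1 \<partial>M)"
  proof (rule integral_mono_AE)
    show "integrable M (\<lambda>\<omega>. \<bar>real_cond_exp M (past 0) (indicator ?B) \<omega> - prob ?B\<bar>)"
      using ce(2) by simp
    show "AE \<omega> in M. \<bar>real_cond_exp M (past 0) (indicator ?B) \<omega> - prob ?B\<bar> \<le> 1"
      using ce(1)
    proof eventually_elim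
      case (elim \<omega>)
      then show ?case using prob_le_1[of ?B] measure_nonneg[of M ?B] by linarith
    qed
  qed simp
  then show ?thesis by (simp add: prob_space)
qed

lemma alpha_ge:
  "(\<integral>\<omega>. \<bar>real_cond_exp M (past 0) (indicator {\<omega>\<in>space M. X (int n) \<omega> \<le> t}) \<omega>
     - prob {\<omega>\<in>space M. X (int n) \<omega> \<le> t}\<bar> \<partial>M) \<le> \<alpha> n"
  unfolding alpha_inf1_def alpha_tilde_def past_0[symmetric]
  by (rule cSUP_upper[OF UNIV_I]) (auto intro!: bdd_aboveI[of _ 1] alpha_term_le_1)

lemma alpha_le_1: "\<alpha> n \<le> 1"
  unfolding alpha_inf1_def alpha_tilde_def past_0[symmetric]
  by (rule cSUP_least) (auto intro: alpha_term_le_1)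

lemma alpha_nonneg: "0 \<le> \<alpha> n"
  by (rule order_trans[OF _ alpha_ge[of n 0]]) simp

text \<open>After moving to time 0, the covariance is the integral over \<open>A0\<close> of the
  conditional probability of the half-line minus its probability, hence at most the norm in the
  definition of \<alpha>.\<close>

lemma mixing_half_line:
  assumes A: "A \<in> sets (past m)" and k: "m + int l \<le> k"
  shows "\<bar>prob (A \<inter> {\<omega> \<in> space M. X k \<omega> \<in> {..t}}) - prob A * marginal {..t}\<bar> \<le> \<alpha> l"
proof -
  \<comment> \<open>Enlarging the past to time \<open>k - int l\<close> makes the lag exactly
    \<open>l\<close>.\<close>
  have "A \<in> sets (past (k - int l))"
    using A sets_past_mono[of m "k - int l"] k by auto
  then obtain A0 where A0: "A0 \<in> sets (past 0)"
    and eq: "\<And>n J. J \<in> sets borel \<Longrightarrow> prob (A0 \<inter> {\<omega> \<in> space M. X n \<omega> \<in> J}) =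
        prob (A \<inter> {\<omega> \<in> space M. X (n + (k - int l)) \<omega> \<in> J})"
    by (rule past_transfer) blast
  have [measurable]: "A0 \<in> sets M" "A \<in> sets M"
    using A0 A sets_past_subset by blast+
  have pA: "prob A0 = prob A"
    using eq[of UNIV 0] sets.sets_into_space[of A0 M] sets.sets_into_space[of A M]
    by (simp add: Int_absorb2)
  let ?B = "{\<omega>\<in>space M. X (int l) \<omega> \<le> t}"
  let ?Y = "real_cond_exp M (past 0) (indicator ?B)"
  have [measurable]: "?B \<in> sets M" by measurable
  note ce = cond_exp_indicator[where B = ?B and m = 0]
  have intY: "integrable M (\<lambda>\<omega>. indicator A0 \<omega> * ?Y \<omega>)"
    using integrable_mult_indicator[OF \<open>A0 \<in> sets M\<close> ce(2)] by simp
  have "prob (A0 \<inter> ?B) - prob A0 * prob ?B =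
      (\<integral>\<omega>. indicator A0 \<omega> * ?Y \<omega> \<partial>M) - (\<integral>\<omega>. indicator A0 \<omega> * prob ?B \<partial>M)"
    using ce(4)[OF _ A0] by simp
  also have "\<dots> = (\<integral>\<omega>. indicator A0 \<omega> * (?Y \<omega> - prob ?B) \<partial>M)"
    using intY by (subst Bochner_Integration.integral_diff[symmetric])
      (auto simp: algebra_simps emeasure_eq_measure)
  also have "\<bar>\<dots>\<bar> \<le> (\<integral>\<omega>. \<bar>indicator A0 \<omega> * (?Y \<omega> - prob ?B)\<bar> \<partial>M)"
    by (rule integral_abs_bound)
  also have "\<dots> \<le> (\<integral>\<omega>. \<bar>?Y \<omega> - prob ?B\<bar> \<partial>M)"
    using ce(2) by (intro integral_mono') (auto simp: indicator_def)
  also have "\<dots> \<le> \<alpha> l" by (rule alpha_ge)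
  finally have "\<bar>prob (A0 \<inter> ?B) - prob A0 * prob ?B\<bar> \<le> \<alpha> l" .
  moreover have "prob (A0 \<inter> ?B) = prob (A \<inter> {\<omega> \<in> space M. X k \<omega> \<in> {..t}})"
    using eq[of "{..t}" "int l"] by simp
  moreover have "prob ?B = marginal {..t}"
    using prob_X[of "{..t}" "int l"] by simp
  ultimately show ?thesis by (simp add: pA)
qed

text \<open>A downward closed set of reals is empty, everything, a closed half-line or an open one.
  The open half-line is an increasing union of closed ones, and the bound survives the
  limit.\<close>

lemma mixing_lower_set:
  assumes A: "A \<in> sets (past m)" and k: "m + int l \<le> k"
    and L: "\<forall>y\<in>L. \<forall>x\<le>y. x \<in> L"
  shows "L \<in> sets borel"
    "\<bar>prob (A \<inter> {\<omega> \<in> space M. X k \<omega> \<in> L}) - prob A * marginal L\<bar> \<le> \<alpha> l"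
proof -
  have [measurable]: "A \<in> sets M" using A sets_past_subset by blast
  define g where "g S = prob (A \<inter> {\<omega> \<in> space M. X k \<omega> \<in> S}) - prob A * marginal S" for S
  have open_case: "\<bar>g {..<t}\<bar> \<le> \<alpha> l" for t
  proof -
    let ?S = "\<lambda>n. {..t - 1 / real (Suc n)}"
    have U: "(\<Union>n. ?S n) = {..<t}"
    proof (intro equalityI subsetI)
      fix x assume "x \<in> {..<t}"
      then obtain n where "inverse (real (Suc n)) < t - x"
        using reals_Archimedean[of "t - x"] by auto
      then have "x \<in> ?S n" by (simp add: inverse_eq_divide)
      then show "x \<in> (\<Union>n. ?S n)" by blast
    qed (auto intro: le_less_trans)
    have inc: "?S i \<subseteq> ?S j" if "i \<le> j" for i j
      using that by (auto simp: frac_le intro: order_trans)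
    have lim: "(\<lambda>n. prob (C \<inter> {\<omega> \<in> space M. X j \<omega> \<in> ?S n}))
        \<longlonglongrightarrow> prob (C \<inter> {\<omega> \<in> space M. X j \<omega> \<in> {..<t}})" if [measurable]: "C \<in> sets M" for C j
    proof -
      have "(\<lambda>n. prob (C \<inter> {\<omega> \<in> space M. X j \<omega> \<in> ?S n}))
        \<longlonglongrightarrow> prob (\<Union>n. C \<inter> {\<omega> \<in> space M. X j \<omega> \<in> ?S n})"
      proof (rule finite_Lim_measure_incseq)
        show "range (\<lambda>n. C \<inter> {\<omega> \<in> space M. X j \<omega> \<in> ?S n}) \<subseteq> sets M"
          by (intro image_subsetI) measurable
        show "incseq (\<lambda>n. C \<inter> {\<omega> \<in> space M. X j \<omega> \<in> ?S n})"
          using inc by (auto simp: incseq_def subset_iff)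
      qed
      also have "(\<Union>n. C \<inter> {\<omega> \<in> space M. X j \<omega> \<in> ?S n}) = C \<inter> {\<omega> \<in> space M. X j \<omega> \<in> {..<t}}"
        unfolding U[symmetric] by blast
      finally show ?thesis .
    qed
    have "space M \<inter> {\<omega> \<in> space M. X 0 \<omega> \<in> S} = {\<omega> \<in> space M. X 0 \<omega> \<in> S}" for S by blast
    then have "(\<lambda>n. marginal (?S n)) \<longlonglongrightarrow> marginal {..<t}"
      using lim[of "space M" 0] unfolding marginal_def by simp
    then have "(\<lambda>n. \<bar>g (?S n)\<bar>) \<longlonglongrightarrow> \<bar>g {..<t}\<bar>"
      unfolding g_def by (intro tendsto_intros lim) auto
    then show ?thesis
      by (rule Lim_bounded) (use mixing_half_line[OF A k] in \<open>auto simp: g_def\<close>)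
  qed
  consider "L = {}" | "L = UNIV" | t where "L = {..t}" | t where "L = {..<t}"
  proof (cases "L = {} \<or> L = UNIV")
    case False
    then obtain b where b: "b \<notin> L" by auto
    have bound: "x \<le> b" if "x \<in> L" for x using L that b by (meson linear)
    have bdd: "bdd_above L" by (rule bdd_aboveI[OF bound])
    have *: "x \<in> L" if x: "x < Sup L" for x
    proof -
      obtain y where "y \<in> L" "x < y" using x False bdd less_cSup_iff[of L x] by auto
      then show ?thesis using L by (meson less_imp_le)
    qed
    have **: "x \<le> Sup L" if "x \<in> L" for x using cSup_upper[OF that bdd] .
    show ?thesis
    proof (cases "Sup L \<in> L")
      case True
      then have "L = {..Sup L}" using ** L by auto
      then show ?thesis using that(3) by blast
    next
      case False
      then have "L = {..<Sup L}" using * ** by (auto simp: less_le)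
      then show ?thesis using that(4) by blast
    qed
  qed (use that in blast)
  then have "L \<in> sets borel \<and> \<bar>g L\<bar> \<le> \<alpha> l"
  proof cases
    case 1
    then show ?thesis by (simp add: g_def marginal_def alpha_nonneg)
  next
    case 2
    have "A \<inter> space M = A" using sets.sets_into_space[of A M] by auto
    with 2 show ?thesis by (simp add: g_def marginal_def alpha_nonneg prob_space)
  next
    case 3
    then show ?thesis using mixing_half_line[OF A k] by (simp add: g_def)
  next
    case 4
    then show ?thesis using open_case by simp
  qed
  then show "L \<in> sets borel"
    "\<bar>prob (A \<inter> {\<omega> \<in> space M. X k \<omega> \<in> L}) - prob A * marginal L\<bar> \<le> \<alpha> l"
    by (simp_all add: g_def)
qed

text \<open>An interval is the difference of two nested downward closed sets: the points below some
  point of \<open>J\<close>, and the points strictly below all of \<open>J\<close>. Each of them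
  costs one \<alpha>.\<close>

lemma mixing_interval:
  assumes A: "A \<in> sets (past m)" and k: "m + int l \<le> k" and J: "is_interval J"
  shows "\<bar>prob (A \<inter> {\<omega> \<in> space M. X k \<omega> \<in> J}) - prob A * marginal J\<bar> \<le> 2 * \<alpha> l"
proof (cases "J = {}")
  case True
  then show ?thesis by (simp add: marginal_def alpha_nonneg)
next
  case False
  have [measurable]: "A \<in> sets M" using A sets_past_subset by blast
  define U where "U = {x. \<exists>y\<in>J. x \<le> y}"
  define V where "V = {x. \<forall>y\<in>J. x < y}"
  have VU: "V \<subseteq> U" using False by (auto simp: U_def V_def intro: less_imp_le)
  have J_eq: "J = U - V"
    using J unfolding U_def V_def is_interval_1 by (fastforce simp: not_less)
  have "\<forall>y\<in>U. \<forall>x\<le>y. x \<in> U" by (auto simp: U_def intro: order_trans)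
  note UL = mixing_lower_set[OF A k this]
  have "\<forall>y\<in>V. \<forall>x\<le>y. x \<in> V" by (auto simp: V_def intro: le_less_trans)
  note VL = mixing_lower_set[OF A k this]
  have [measurable]: "U \<in> sets borel" "V \<in> sets borel" using UL VL by auto
  have diff: "prob (C \<inter> {\<omega> \<in> space M. X j \<omega> \<in> J}) =
      prob (C \<inter> {\<omega> \<in> space M. X j \<omega> \<in> U}) - prob (C \<inter> {\<omega> \<in> space M. X j \<omega> \<in> V})"
    if [measurable]: "C \<in> sets M" for C j
  proof -
    have "C \<inter> {\<omega> \<in> space M. X j \<omega> \<in> J} =
        C \<inter> {\<omega> \<in> space M. X j \<omega> \<in> U} - C \<inter> {\<omega> \<in> space M. X j \<omega> \<in> V}"
      using VU by (auto simp: J_eq)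
    then show ?thesis
      using VU by (simp add: finite_measure_Diff subset_iff)
  qed
  have "space M \<inter> {\<omega> \<in> space M. X 0 \<omega> \<in> S} = {\<omega> \<in> space M. X 0 \<omega> \<in> S}" for S by blast
  then have "marginal J = marginal U - marginal V"
    using diff[of "space M" 0] unfolding marginal_def by simp
  then have "prob A * marginal J = prob A * marginal U - prob A * marginal V"
    by (simp add: right_diff_distrib)
  with diff[of A k] UL(2) VL(2) show ?thesis by simp
qed

end

section \<open>Decomposition of the centred count\<close>

text \<open>In the expanded square only pairs at distance less than \<open>q\<close> survive. Each
  is at most the integral of \<open>\<bar>D k\<bar>\<close>, since \<open>\<bar>D l\<bar>\<close> is
  at most 1, and every \<open>k\<close> has at most \<open>2 * q\<close> partners.\<close>

lemma (in finite_measure) integral_square_sum_le: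
  fixes D :: "nat \<Rightarrow> 'a \<Rightarrow> real"
  assumes [measurable]: "\<And>k. D k \<in> borel_measurable M"
    and bound: "\<And>k. AE \<omega> in M. \<bar>D k \<omega>\<bar> \<le> 1"
    and L1: "\<And>k. (\<integral>\<omega>. \<bar>D k \<omega>\<bar> \<partial>M) \<le> c k"
    and orth: "\<And>k l. l + q \<le> k \<Longrightarrow> (\<integral>\<omega>. D l \<omega> * D k \<omega> \<partial>M) = 0"
  shows "integrable M (\<lambda>\<omega>. (\<Sum>k=1..n. D k \<omega>)\<^sup>2)"
    "(\<integral>\<omega>. (\<Sum>k=1..n. D k \<omega>)\<^sup>2 \<partial>M) \<le> 2 * real q * (\<Sum>k=1..n. c k)"
proof -
  have int_prod: "integrable M (\<lambda>\<omega>. D k \<omega> * D l \<omega>)" for k l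
  proof (rule integrable_const_bound[where B = 1])
    show "AE \<omega> in M. norm (D k \<omega> * D l \<omega>) \<le> 1"
      using bound[of k] bound[of l] by eventually_elim (simp add: abs_mult mult_le_one)
  qed simp
  have int_abs: "integrable M (\<lambda>\<omega>. \<bar>D k \<omega>\<bar>)" for k
    by (rule integrable_const_bound[where B = 1]) (use bound[of k] in auto)
  have c: "0 \<le> c k" for k by (rule order_trans[OF _ L1]) simp
  have sq: "(\<Sum>k=1..n. D k \<omega>)\<^sup>2 = (\<Sum>k=1..n. \<Sum>l=1..n. D k \<omega> * D l \<omega>)" for \<omega>
    by (simp add: power2_eq_square sum_product)
  show "integrable M (\<lambda>\<omega>. (\<Sum>k=1..n. D k \<omega>)\<^sup>2)"
    unfolding sq by (intro Bochner_Integration.integrable_sum int_prod)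
  have prod_le: "(\<integral>\<omega>. D k \<omega> * D l \<omega> \<partial>M) \<le> (if k < l + q \<and> l < k + q then c k else 0)" for k l
  proof (cases "k < l + q \<and> l < k + q")
    case True
    have "(\<integral>\<omega>. D k \<omega> * D l \<omega> \<partial>M) \<le> (\<integral>\<omega>. \<bar>D k \<omega>\<bar> \<partial>M)"
    proof (rule integral_mono_AE[OF int_prod int_abs])
      show "AE \<omega> in M. D k \<omega> * D l \<omega> \<le> \<bar>D k \<omega>\<bar>"
        using bound[of l]
      proof eventually_elim
        case (elim \<omega>)
        have "D k \<omega> * D l \<omega> \<le> \<bar>D k \<omega>\<bar> * \<bar>D l \<omega>\<bar>" by (simp add: abs_mult[symmetric])
        also have "\<dots> \<le> \<bar>D k \<omega>\<bar>" using elim by (simp add: mult_left_le)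
        finally show ?case .
      qed
    qed
    with L1[of k] True show ?thesis by simp
  next
    case False
    then show ?thesis using orth[of l k] orth[of k l] by (auto simp: mult.commute not_less)
  qed
  have card_le: "card {l \<in> {1..n}. k < l + q \<and> l < k + q} \<le> 2 * q" for k
  proof -
    have "card {l \<in> {1..n}. k < l + q \<and> l < k + q} \<le> card {k + 1 - q..<k + q}"
      by (rule card_mono) auto
    also have "\<dots> \<le> 2 * q" by simp
    finally show ?thesis .
  qed
  have "(\<integral>\<omega>. (\<Sum>k=1..n. D k \<omega>)\<^sup>2 \<partial>M) = (\<Sum>k=1..n. \<Sum>l=1..n. \<integral>\<omega>. D k \<omega> * D l \<omega> \<partial>M)"
    unfolding sq by (simp add: int_prod)
  also have "\<dots> \<le> (\<Sum>k=1..n. \<Sum>l=1..n. if k < l + q \<and> l < k + q then c k else 0)"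
    by (intro sum_mono prod_le)
  also have "\<dots> = (\<Sum>k=1..n. real (card {l \<in> {1..n}. k < l + q \<and> l < k + q}) * c k)"
    by (simp add: sum.inter_filter[symmetric])
  also have "\<dots> \<le> (\<Sum>k=1..n. real (2 * q) * c k)"
    by (intro sum_mono mult_right_mono c of_nat_mono card_le)
  finally show "(\<integral>\<omega>. (\<Sum>k=1..n. D k \<omega>)\<^sup>2 \<partial>M) \<le> 2 * real q * (\<Sum>k=1..n. c k)"
    by (simp add: sum_distrib_left)
qed

context stationary_sequence
begin

lemma events_interval:
  assumes "is_interval J"
  shows "{\<omega> \<in> space M. X k \<omega> \<in> J} \<in> sets M"
proof -
  have [measurable]: "J \<in> sets borel" using assms by (rule real_interval_borel_measurable)
  show ?thesis by measurable
qed

text \<open>Since \<open>\<bar>z\<bar>\<close> is twice the positive part of \<open>z\<close> minus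
  \<open>z\<close>, and \<open>Y - marginal J\<close> has mean 0, the norm is twice the covariance
  with the event \<open>A\<close> where \<open>Y\<close> is at least its mean. That event lies in
  the past, so \<open>mixing_interval\<close> applies.\<close>

lemma cond_exp_deviation:
  assumes J: "is_interval J" and k: "m + int l \<le> k"
  defines "Y \<equiv> real_cond_exp M (past m) (indicator {\<omega> \<in> space M. X k \<omega> \<in> J})"
  shows "(\<integral>\<omega>. \<bar>Y \<omega> - marginal J\<bar> \<partial>M) \<le> 4 * \<alpha> l"
proof -
  let ?B = "{\<omega> \<in> space M. X k \<omega> \<in> J}"
  note ce = cond_exp_indicator[OF events_interval[OF J, of k], where m = m, folded Y_def]
  define A where "A = {\<omega> \<in> space M. marginal J \<le> Y \<omega>}"
  have "{\<omega> \<in> space (past m). marginal J \<le> Y \<omega>} \<in> sets (past m)"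
    unfolding Y_def by measurable
  then have A: "A \<in> sets (past m)" by (simp add: A_def)
  then have [measurable]: "A \<in> sets M" using sets_past_subset by blast
  have intY: "integrable M (\<lambda>\<omega>. indicator A \<omega> * Y \<omega>)"
    using integrable_mult_indicator[OF \<open>A \<in> sets M\<close> ce(2)] by simp
  have "(\<integral>\<omega>. \<bar>Y \<omega> - marginal J\<bar> \<partial>M) =
      (\<integral>\<omega>. 2 * (indicator A \<omega> * Y \<omega> - indicator A \<omega> * marginal J) - (Y \<omega> - marginal J) \<partial>M)"
    by (rule Bochner_Integration.integral_cong) (auto simp: A_def indicator_def)
  also have "\<dots> = 2 * ((\<integral>\<omega>. indicator A \<omega> * Y \<omega> \<partial>M) - prob A * marginal J) -
      (expectation Y - marginal J)"
    using intY ce(2) by (simp add: emeasure_eq_measure prob_space)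
  also have "\<dots> = 2 * (prob (A \<inter> ?B) - prob A * marginal J)"
    using ce(3) ce(4)[OF A] prob_X[OF real_interval_borel_measurable[OF J], of k] by simp
  also have "\<dots> \<le> 4 * \<alpha> l"
    using mixing_interval[OF A k J] by simp
  finally show ?thesis .
qed

text \<open>Conditioning on the past at lag \<open>q\<close> yields \<open>U\<close> and
  \<open>V\<close>. The past at lag \<open>q\<close> is also separated from time \<open>k\<close> by
  any \<open>l \<le> q\<close>, so the bound on \<open>V\<close> may be stated at a smaller lag than
  the one governing \<open>U\<close>.\<close>

lemma count_decomposition:
  assumes I: "\<And>k. k > 0 \<Longrightarrow> is_interval (I k)" and lq: "l \<le> q"
  defines "B \<equiv> (\<lambda>k. {\<omega> \<in> space M. X (int k) \<omega> \<in> I k})"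
  obtains U V where "\<forall>\<omega>. bc_count B n \<omega> - (\<Sum>k=1..n. marginal (I k)) = U \<omega> + V \<omega>"
    "U \<in> borel_measurable M" "integrable M (\<lambda>\<omega>. (U \<omega>)\<^sup>2)" "integrable M V"
    "expectation (\<lambda>\<omega>. (U \<omega>)\<^sup>2) \<le> 4 * real q * (\<Sum>k=1..n. marginal (I k))"
    "expectation (\<lambda>\<omega>. \<bar>V \<omega>\<bar>) \<le> 4 * real n * \<alpha> l"
proof -
  define F where "F k = past (int k - int q)" for k :: nat
  define Y where "Y k = real_cond_exp M (F k) (indicator (B k))" for k :: nat
  \<comment> \<open>\<open>I 0\<close> is arbitrary, so the term at 0 is set to 0; this gives the
    bounds on \<open>D\<close> for all indices, as the square estimate requires.\<close>
  define D where "D k \<omega> = (if k = 0 then 0 else indicator (B k) \<omega> - Y k \<omega>)" for k \<omega>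
  have B [measurable]: "B k \<in> sets M" if "k > 0" for k
    unfolding B_def by (intro events_interval I that)
  have pB: "prob (B k) = marginal (I k)" if "k > 0" for k
    unfolding B_def by (intro prob_X real_interval_borel_measurable I that)
  have ce: "AE \<omega> in M. 0 \<le> Y k \<omega> \<and> Y k \<omega> \<le> 1" "integrable M (Y k)"
    "expectation (Y k) = prob (B k)" if "k > 0" for k
    unfolding Y_def F_def by (intro cond_exp_indicator B that)+
  have Y_meas [measurable]: "Y k \<in> borel_measurable M" for k by (simp add: Y_def)
  have D_meas [measurable]: "D k \<in> borel_measurable M" for k
    unfolding D_def by (cases "k = 0") auto
  have D_bound: "AE \<omega> in M. \<bar>D k \<omega>\<bar> \<le> 1" for k
  proof (cases "k = 0")
    case False
    then have "AE \<omega> in M. 0 \<le> Y k \<omega> \<and> Y k \<omega> \<le> 1" using ce(1) by simp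
    then show ?thesis by eventually_elim (auto simp: D_def indicator_def)
  qed (simp add: D_def)
  have D_L1: "(\<integral>\<omega>. \<bar>D k \<omega>\<bar> \<partial>M) \<le> 2 * (if k = 0 then 0 else marginal (I k))" for k
  proof (cases "k = 0")
    case False
    then have k: "k > 0" by simp
    have int: "integrable M (indicator (B k) :: 'a \<Rightarrow> real)" "integrable M (Y k)"
      using k B ce(2) by (auto simp: emeasure_eq_measure)
    have "(\<integral>\<omega>. \<bar>D k \<omega>\<bar> \<partial>M) \<le> (\<integral>\<omega>. indicator (B k) \<omega> + Y k \<omega> \<partial>M)"
    proof (rule integral_mono_AE)
      show "integrable M (\<lambda>\<omega>. \<bar>D k \<omega>\<bar>)" using int k by (simp add: D_def)
      show "integrable M (\<lambda>\<omega>. indicator (B k) \<omega> + Y k \<omega>)" using int by simp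
      show "AE \<omega> in M. \<bar>D k \<omega>\<bar> \<le> indicator (B k) \<omega> + Y k \<omega>"
        using ce(1)[OF k] by eventually_elim (auto simp: D_def indicator_def)
    qed
    also have "\<dots> = 2 * marginal (I k)"
      using int ce(3)[OF k] B[OF k] pB[OF k] by simp
    finally show ?thesis using k by simp
  qed (simp add: D_def)
  \<comment> \<open>For \<open>l + q \<le> k\<close> the variable \<open>D l\<close> is known at the
    time on which \<open>Y k\<close> conditions, so replacing the indicator of \<open>B k\<close> by
    \<open>Y k\<close> does not change the integral against \<open>D l\<close>.\<close>
  have D_orth: "(\<integral>\<omega>. D l \<omega> * D k \<omega> \<partial>M) = 0" if lk: "l + q \<le> k" for k l
  proof (cases "k = 0 \<or> l = 0")
    case False
    then have k: "k > 0" and l: "l > 0" by auto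
    interpret S: finite_measure_subalgebra M "F k"
      unfolding F_def by (rule finite_subalgebra_past)
    have sub1: "sets (past (int l)) \<subseteq> sets (F k)" and sub2: "sets (F l) \<subseteq> sets (F k)"
      unfolding F_def by (intro sets_past_mono; use lk in simp)+
    have "X (int l) \<in> borel_measurable (past (int l))" by (rule X_past) simp
    then have "X (int l) -` I l \<inter> space (past (int l)) \<in> sets (past (int l))"
      by (rule measurable_sets) (intro real_interval_borel_measurable I l)
    then have "B l \<in> sets (F k)"
      using sub1 by (auto simp: B_def vimage_def Int_def conj_commute)
    moreover have "Y l \<in> borel_measurable (F k)"
    proof (rule measurable_mono[THEN subsetD])
      show "Y l \<in> borel_measurable (F l)" by (simp add: Y_def)
    qed (use sub2 in \<open>auto simp: F_def\<close>)
    ultimately have DlF: "D l \<in> borel_measurable (F k)"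
      using l by (simp add: D_def[abs_def])
    have intg: "integrable M (\<lambda>\<omega>. D l \<omega> * indicator (B k) \<omega>)"
      by (rule integrable_const_bound[where B = 1])
         (use D_bound[of l] B[OF k] in \<open>auto simp: indicator_def elim!: eventually_mono\<close>)
    have "(\<integral>\<omega>. D l \<omega> * Y k \<omega> \<partial>M) = (\<integral>\<omega>. D l \<omega> * indicator (B k) \<omega> \<partial>M)"
      unfolding Y_def using B[OF k] by (intro S.real_cond_exp_intg(2) intg DlF) simp
    moreover have "integrable M (\<lambda>\<omega>. D l \<omega> * Y k \<omega>)"
      unfolding Y_def using B[OF k] by (intro S.real_cond_exp_intg(1) intg DlF) simp
    ultimately show ?thesis
      using k intg by (simp add: D_def[of k] right_diff_distrib)
  qed (auto simp: D_def)
  define U where "U \<omega> = (\<Sum>k=1..n. D k \<omega>)" for \<omega>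
  define V where "V \<omega> = (\<Sum>k=1..n. Y k \<omega> - marginal (I k))" for \<omega>
  have nonneg: "0 \<le> marginal J" for J by (simp add: marginal_def)
  note sq = integral_square_sum_le[of D "\<lambda>k. 2 * (if k = 0 then 0 else marginal (I k))" q n,
      OF D_meas D_bound D_L1 D_orth, folded U_def]
  show thesis
  proof
    show "\<forall>\<omega>. bc_count B n \<omega> - (\<Sum>k=1..n. marginal (I k)) = U \<omega> + V \<omega>"
    proof
      fix \<omega>
      have "U \<omega> = (\<Sum>k=1..n. indicator (B k) \<omega> - Y k \<omega>)"
        unfolding U_def by (intro sum.cong) (auto simp: D_def)
      then show "bc_count B n \<omega> - (\<Sum>k=1..n. marginal (I k)) = U \<omega> + V \<omega>"
        by (simp add: bc_count_def V_def sum_subtractf)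
    qed
    show "U \<in> borel_measurable M" unfolding U_def[abs_def] by measurable
    show "integrable M (\<lambda>\<omega>. (U \<omega>)\<^sup>2)" by (rule sq(1))
    show intV: "integrable M V"
      unfolding V_def[abs_def] using ce(2) by (intro Bochner_Integration.integrable_sum) auto
    have "expectation (\<lambda>\<omega>. (U \<omega>)\<^sup>2) \<le>
        2 * real q * (\<Sum>k=1..n. 2 * (if k = 0 then 0 else marginal (I k)))"
      by (rule sq(2))
    also have "(\<Sum>k=1..n. 2 * (if k = 0 then 0 else marginal (I k))) =
        2 * (\<Sum>k=1..n. marginal (I k))"
      unfolding sum_distrib_left by (intro sum.cong) auto
    finally show "expectation (\<lambda>\<omega>. (U \<omega>)\<^sup>2) \<le> 4 * real q * (\<Sum>k=1..n. marginal (I k))"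
      by simp
    have "expectation (\<lambda>\<omega>. \<bar>V \<omega>\<bar>) \<le> (\<integral>\<omega>. (\<Sum>k=1..n. \<bar>Y k \<omega> - marginal (I k)\<bar>) \<partial>M)"
      unfolding V_def using ce(2)
      by (intro integral_mono' sum_abs Bochner_Integration.integrable_sum) (auto intro: sum_nonneg)
    also have "\<dots> = (\<Sum>k=1..n. \<integral>\<omega>. \<bar>Y k \<omega> - marginal (I k)\<bar> \<partial>M)"
      using ce(2) by (intro Bochner_Integration.integral_sum) auto
    also have "\<dots> \<le> (\<Sum>k=1..n. 4 * \<alpha> l)"
    proof (rule sum_mono)
      fix k assume "k \<in> {1..n}"
      then show "(\<integral>\<omega>. \<bar>Y k \<omega> - marginal (I k)\<bar> \<partial>M) \<le> 4 * \<alpha> l"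
        unfolding Y_def F_def B_def using lq by (intro cond_exp_deviation I) auto
    qed
    finally show "expectation (\<lambda>\<omega>. \<bar>V \<omega>\<bar>) \<le> 4 * real n * \<alpha> l" by simp
  qed
qed

end

section \<open>L1 and almost sure convergence\<close>

lemma filterlim_partial_sums_at_top:
  fixes m :: "nat \<Rightarrow> real"
  assumes nonneg: "\<And>k. 0 \<le> m k" and "\<not> summable (\<lambda>k. m (Suc k))"
  shows "filterlim (\<lambda>n. \<Sum>k=1..n. m k) at_top sequentially"
proof (subst filterlim_at_top, intro allI)
  fix Z :: real
  have "\<exists>n. Z < (\<Sum>k\<le>n. m (Suc k))"
  proof (rule ccontr)
    assume "\<not> ?thesis"
    then have "summable (\<lambda>k. m (Suc k))"
      using nonneg by (intro bounded_imp_summable[where B = Z]) (auto simp: not_less)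
    with assms show False by simp
  qed
  then obtain n where n: "Z < (\<Sum>k\<le>n. m (Suc k))" by blast
  have "Z \<le> (\<Sum>k=1..N. m k)" if "Suc n \<le> N" for N
  proof -
    have "(\<Sum>k\<le>n. m (Suc k)) = (\<Sum>k=1..Suc n. m k)"
      by (simp only: One_nat_def sum.atLeast1_atMost_eq lessThan_Suc_atMost)
    also have "\<dots> \<le> (\<Sum>k=1..N. m k)" using that nonneg by (intro sum_mono2) auto
    finally show ?thesis using n by simp
  qed
  then show "\<forall>\<^sub>F N in sequentially. Z \<le> (\<Sum>k=1..N. m k)"
    unfolding eventually_sequentially by blast
qed

text \<open>By monotone convergence the sum of the \<open>f j\<close> has finite integral, so it
  converges almost everywhere and its terms tend to 0.\<close>

lemma AE_tendsto_zero_of_summable_integrals: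
  fixes f :: "nat \<Rightarrow> 'a \<Rightarrow> real"
  assumes int: "\<And>j. integrable M (f j)" and nonneg: "\<And>j \<omega>. 0 \<le> f j \<omega>"
    and le: "\<And>j. (\<integral>\<omega>. f j \<omega> \<partial>M) \<le> w j" and w: "summable w"
  shows "AE \<omega> in M. (\<lambda>j. f j \<omega>) \<longlonglongrightarrow> 0"
proof -
  have [measurable]: "f j \<in> borel_measurable M" for j using int by simp
  have s: "summable (\<lambda>j. \<integral>\<omega>. f j \<omega> \<partial>M)"
    by (rule summable_comparison_test'[OF w, of 0]) (use le nonneg in simp)
  have "(\<integral>\<^sup>+\<omega>. (\<Sum>j. ennreal (f j \<omega>)) \<partial>M) = (\<Sum>j. \<integral>\<^sup>+\<omega>. ennreal (f j \<omega>) \<partial>M)"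
    by (rule nn_integral_suminf) simp
  also have "\<dots> = (\<Sum>j. ennreal (\<integral>\<omega>. f j \<omega> \<partial>M))"
    using int nonneg by (simp add: nn_integral_eq_integral)
  also have "\<dots> \<noteq> \<infinity>"
    using s nonneg by (simp add: suminf_ennreal2)
  finally have "AE \<omega> in M. (\<Sum>j. ennreal (f j \<omega>)) \<noteq> \<infinity>"
    by (intro nn_integral_noteq_infinite) simp_all
  then show ?thesis
  proof eventually_elim
    case (elim \<omega>)
    then have "summable (\<lambda>j. f j \<omega>)"
      using nonneg by (intro summable_suminf_not_top) (simp_all add: infinity_ennreal_def)
    then show ?case by (rule summable_LIMSEQ_zero)
  qed
qed

text \<open>The variance of \<open>\<bar>U\<bar>\<close> is non-negative.\<close>

lemma (in prob_space) expectation_abs_le_sqrt: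
  fixes U :: "'a \<Rightarrow> real"
  assumes [measurable]: "U \<in> borel_measurable M" and sq: "integrable M (\<lambda>\<omega>. (U \<omega>)\<^sup>2)"
  shows "expectation (\<lambda>\<omega>. \<bar>U \<omega>\<bar>) \<le> sqrt (expectation (\<lambda>\<omega>. (U \<omega>)\<^sup>2))"
proof -
  have "integrable M U" by (rule square_integrable_imp_integrable[OF assms])
  then have int: "integrable M (\<lambda>\<omega>. \<bar>U \<omega>\<bar>)" by (rule integrable_abs)
  have sq': "integrable M (\<lambda>\<omega>. \<bar>U \<omega>\<bar>\<^sup>2)" unfolding power2_abs by (rule sq)
  have "0 \<le> variance (\<lambda>\<omega>. \<bar>U \<omega>\<bar>)" by (rule variance_positive)
  also have "\<dots> = expectation (\<lambda>\<omega>. \<bar>U \<omega>\<bar>\<^sup>2) - (expectation (\<lambda>\<omega>. \<bar>U \<omega>\<bar>))\<^sup>2"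
    by (rule variance_eq[OF int sq'])
  finally have "(expectation (\<lambda>\<omega>. \<bar>U \<omega>\<bar>))\<^sup>2 \<le> expectation (\<lambda>\<omega>. (U \<omega>)\<^sup>2)"
    unfolding power2_abs by linarith
  then show ?thesis by (rule real_le_rsqrt)
qed

section \<open>Convergence criteria in terms of lags\<close>

context stationary_sequence
begin

lemma marginal_nonneg: "0 \<le> marginal J"
  by (simp add: marginal_def)

lemma marginal_le_1: "marginal J \<le> 1"
  by (simp add: marginal_def)

lemma prob_interval_event:
  assumes "is_interval J"
  shows "prob {\<omega> \<in> space M. X k \<omega> \<in> J} = marginal J"
  by (intro prob_X real_interval_borel_measurable assms)

lemma bc_mean_eq:
  assumes I: "\<And>k. k > 0 \<Longrightarrow> is_interval (I k)"
  shows "bc_mean M (\<lambda>k. {\<omega> \<in> space M. X (int k) \<omega> \<in> I k}) n = (\<Sum>k=1..n. marginal (I k))"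
proof -
  let ?B = "\<lambda>k. {\<omega> \<in> space M. X (int k) \<omega> \<in> I k}"
  have "bc_mean M ?B n = (\<Sum>k=1..n. \<integral>\<omega>. indicator (?B k) \<omega> \<partial>M)"
    unfolding bc_mean_def bc_count_def
    using events_interval[OF I]
    by (intro Bochner_Integration.integral_sum) (auto simp: emeasure_eq_measure)
  also have "\<dots> = (\<Sum>k=1..n. marginal (I k))"
    using events_interval[OF I] prob_interval_event[OF I] by (intro sum.cong) auto
  finally show ?thesis .
qed

text \<open>After division by \<open>E n\<close>, the part \<open>U\<close> of the decomposition
  contributes at most \<open>2 * sqrt (q n / E n)\<close> and the part \<open>V\<close> at most
  \<open>4 * n * \<alpha> (l n) / E n\<close>.\<close>

lemma L1_borel_cantelli_of_lags:
  fixes l q :: "nat \<Rightarrow> nat"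
  assumes I: "\<And>k. k > 0 \<Longrightarrow> is_interval (I k)"
  defines "E \<equiv> \<lambda>n. \<Sum>k=1..n. marginal (I k)"
  assumes div: "\<not> summable (\<lambda>k. marginal (I (Suc k)))"
    and lq: "\<And>n. l n \<le> q n"
    and q_lim: "(\<lambda>n. real (q n) / E n) \<longlonglongrightarrow> 0"
    and l_lim: "(\<lambda>n. real n * \<alpha> (l n) / E n) \<longlonglongrightarrow> 0"
  shows "L1_borel_cantelli_seq M (\<lambda>k. {\<omega> \<in> space M. X (int k) \<omega> \<in> I k})"
proof -
  let ?B = "\<lambda>k. {\<omega> \<in> space M. X (int k) \<omega> \<in> I k}"
  have E_top: "filterlim E at_top sequentially"
    unfolding E_def by (intro filterlim_partial_sums_at_top marginal_nonneg div)
  have E_eq: "E n = (\<Sum>k=1..n. marginal (I k))" for n by (simp add: E_def)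
  have mean: "bc_mean M ?B n = E n" for n
    unfolding E_eq by (rule bc_mean_eq[where I = I, OF I])
  have le: "(\<integral>\<omega>. \<bar>bc_count ?B n \<omega> / E n - 1\<bar> \<partial>M) \<le>
      2 * sqrt (real (q n) / E n) + 4 * (real n * \<alpha> (l n) / E n)" if En: "0 < E n" for n
  proof -
    have "\<exists>U V. (\<forall>\<omega>. bc_count ?B n \<omega> - E n = U \<omega> + V \<omega>) \<and> U \<in> borel_measurable M \<and>
      integrable M (\<lambda>\<omega>. (U \<omega>)\<^sup>2) \<and> integrable M V \<and>
      expectation (\<lambda>\<omega>. (U \<omega>)\<^sup>2) \<le> 4 * real (q n) * E n \<and>
      expectation (\<lambda>\<omega>. \<bar>V \<omega>\<bar>) \<le> 4 * real n * \<alpha> (l n)"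
      unfolding E_eq
      by (rule count_decomposition[where I = I and n = n, OF I lq[of n]])
         (assumption, intro exI conjI, assumption+)
    then obtain U V where UV: "\<forall>\<omega>. bc_count ?B n \<omega> - E n = U \<omega> + V \<omega>"
      "U \<in> borel_measurable M" "integrable M (\<lambda>\<omega>. (U \<omega>)\<^sup>2)" "integrable M V"
      "expectation (\<lambda>\<omega>. (U \<omega>)\<^sup>2) \<le> 4 * real (q n) * E n"
      "expectation (\<lambda>\<omega>. \<bar>V \<omega>\<bar>) \<le> 4 * real n * \<alpha> (l n)"
      by (elim exE conjE)
    have intU: "integrable M U" using UV(2,3) by (rule square_integrable_imp_integrable)
    have "(\<integral>\<omega>. \<bar>bc_count ?B n \<omega> / E n - 1\<bar> \<partial>M) = (\<integral>\<omega>. \<bar>U \<omega> + V \<omega>\<bar> / E n \<partial>M)"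
    proof (rule Bochner_Integration.integral_cong)
      fix \<omega>
      have "bc_count ?B n \<omega> / E n - 1 = (bc_count ?B n \<omega> - E n) / E n"
        using En by (simp add: diff_divide_distrib)
      then show "\<bar>bc_count ?B n \<omega> / E n - 1\<bar> = \<bar>U \<omega> + V \<omega>\<bar> / E n"
        using En by (simp add: UV(1))
    qed simp
    also have "\<dots> \<le> (\<integral>\<omega>. (\<bar>U \<omega>\<bar> + \<bar>V \<omega>\<bar>) / E n \<partial>M)"
      using intU UV(4) En by (intro integral_mono divide_right_mono) auto
    also have "\<dots> = (expectation (\<lambda>\<omega>. \<bar>U \<omega>\<bar>) + expectation (\<lambda>\<omega>. \<bar>V \<omega>\<bar>)) / E n"
      using intU UV(4) by simp
    also have "\<dots> \<le> (sqrt (4 * real (q n) * E n) + 4 * real n * \<alpha> (l n)) / E n"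
    proof (intro divide_right_mono add_mono UV(6))
      show "expectation (\<lambda>\<omega>. \<bar>U \<omega>\<bar>) \<le> sqrt (4 * real (q n) * E n)"
        using expectation_abs_le_sqrt[OF UV(2,3)] real_sqrt_le_mono[OF UV(5)] by (rule order_trans)
    qed (use En in simp)
    also have "sqrt (4 * real (q n) * E n) = 2 * sqrt (real (q n) / E n) * E n"
    proof -
      have "4 * real (q n) * E n = (real (q n) / E n) * (2 * E n)\<^sup>2"
        using En by (simp add: power2_eq_square)
      then have "sqrt (4 * real (q n) * E n) = sqrt (real (q n) / E n) * sqrt ((2 * E n)\<^sup>2)"
        by (simp only: real_sqrt_mult)
      also have "sqrt ((2 * E n)\<^sup>2) = 2 * E n" using En by (subst real_sqrt_abs) simp
      finally show ?thesis by simp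
    qed
    finally show ?thesis using En by (simp add: add_divide_distrib)
  qed
  have "(\<lambda>n. \<integral>\<omega>. \<bar>bc_count ?B n \<omega> / E n - 1\<bar> \<partial>M) \<longlonglongrightarrow> 0"
  proof (rule tendsto_sandwich[OF _ _ tendsto_const])
    show "(\<lambda>n. 2 * sqrt (real (q n) / E n) + 4 * (real n * \<alpha> (l n) / E n)) \<longlonglongrightarrow> 0"
      using tendsto_add[OF tendsto_mult[OF tendsto_const tendsto_real_sqrt[OF q_lim]]
          tendsto_mult[OF tendsto_const l_lim], of 2 4] by simp
    have "\<forall>\<^sub>F n in sequentially. 0 < E n"
      using E_top unfolding filterlim_at_top_dense by blast
    then show "\<forall>\<^sub>F n in sequentially. (\<integral>\<omega>. \<bar>bc_count ?B n \<omega> / E n - 1\<bar> \<partial>M) \<le>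
        2 * sqrt (real (q n) / E n) + 4 * (real n * \<alpha> (l n) / E n)"
      by eventually_elim (rule le)
  qed simp
  then show ?thesis
    unfolding L1_borel_cantelli_seq_def mean using div by (simp add: prob_interval_event I)
qed

text \<open>Along the subsequence, the second moment of \<open>U / E\<close> and the first absolute
  moment of \<open>V / E\<close> are both bounded by \<open>4 * v (N j)\<close>, which is summable.
  Monotonicity of the count then fills in the remaining indices.\<close>

lemma strongly_borel_cantelli_of_lags:
  fixes q :: "nat \<Rightarrow> nat" and u :: "nat \<Rightarrow> real"
  assumes I: "\<And>k. k > 0 \<Longrightarrow> is_interval (I k)"
  defines "E \<equiv> \<lambda>n. \<Sum>k=1..n. marginal (I k)"
  assumes pos: "0 < marginal (I 1)"
    and div: "\<not> summable (\<lambda>k. marginal (I (Suc k)))"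
    and u: "\<And>n. 0 < n \<Longrightarrow> 0 \<le> u n"
    and sum_u: "summable (\<lambda>k. marginal (I (Suc k)) / E (Suc k) * u (Suc k))"
    and sum_q: "summable (\<lambda>k. marginal (I (Suc k)) / (E (Suc k))\<^sup>2 * real (q (Suc k)))"
    and mix: "\<And>n. 0 < n \<Longrightarrow> 0 < marginal (I n) \<Longrightarrow> \<alpha> (q n) \<le> E n * u n / real n"
  shows "strongly_borel_cantelli_seq M (\<lambda>k. {\<omega> \<in> space M. X (int k) \<omega> \<in> I k})"
proof -
  let ?B = "\<lambda>k. {\<omega> \<in> space M. X (int k) \<omega> \<in> I k}"
  let ?m = "\<lambda>k. marginal (I k)"
  have E_top: "filterlim E at_top sequentially"
    unfolding E_def by (intro filterlim_partial_sums_at_top marginal_nonneg div)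
  have E_eq: "E n = (\<Sum>k=1..n. ?m k)" for n by (simp add: E_def)
  have mean: "bc_mean M ?B n = E n" for n
    unfolding E_eq by (rule bc_mean_eq[where I = I, OF I])
  have E_mono: "mono E"
    unfolding E_def by (intro monoI sum_mono2) (auto simp: marginal_nonneg)
  have E_nonneg: "0 \<le> E n" for n unfolding E_def by (intro sum_nonneg marginal_nonneg)
  \<comment> \<open>The sum of the two error bounds, up to a factor 4. At 0 the sign of
    \<open>u\<close> is unknown, hence the separate value.\<close>
  define v where "v n = (if n = 0 then 0 else u n + (real (q n) + 1) / E n)" for n
  have v_nonneg: "0 \<le> v n" for n unfolding v_def using u E_nonneg by simp
  have "summable (\<lambda>k. ?m (Suc k) / E (Suc k) * u (Suc k) +
      (?m (Suc k) / (E (Suc k))\<^sup>2 * real (q (Suc k)) + ?m (Suc k) / (E (Suc k))\<^sup>2))"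
    using summable_div_square_partial_sums[of ?m, OF marginal_nonneg pos]
    unfolding E_eq[symmetric] by (intro summable_add sum_u sum_q)
  moreover have "?m (Suc k) / E (Suc k) * v (Suc k) = ?m (Suc k) / E (Suc k) * u (Suc k) +
      (?m (Suc k) / (E (Suc k))\<^sup>2 * real (q (Suc k)) + ?m (Suc k) / (E (Suc k))\<^sup>2)" for k
    by (simp add: v_def power2_eq_square distrib_left add_divide_distrib)
  ultimately have v_summable: "summable (\<lambda>k. ?m (Suc k) / E (Suc k) * v (Suc k))"
    by simp
  have AE_c: "AE \<omega> in M. \<forall>\<^sub>F n in sequentially.
      1 / c ^ 3 \<le> bc_count ?B n \<omega> / E n \<and> bc_count ?B n \<omega> / E n \<le> c ^ 3" if c: "c > 1" for c
  proof -
    obtain N J where NJ: "summable (\<lambda>j. v (N j))" "\<And>j. c ^ (J + j) < E (N j)"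
      "\<And>j. E (N j) \<le> c ^ (J + j + 1)" "\<And>j. 0 < N j" "\<And>j. 0 < ?m (N j)"
      using geometric_subsequence[of ?m v c, OF marginal_nonneg marginal_le_1 v_nonneg
          E_top[unfolded E_def] v_summable[unfolded E_def] c] unfolding E_eq[symmetric] by blast
    have EN: "0 < E (N j)" for j
      using NJ(2)[of j] c by (meson less_trans zero_less_power zero_less_one)
    define P where "P j U V \<longleftrightarrow> (\<forall>\<omega>. bc_count ?B (N j) \<omega> - E (N j) = U \<omega> + V \<omega>) \<and>
      integrable M (\<lambda>\<omega>. (U \<omega>)\<^sup>2) \<and> integrable M V \<and>
      expectation (\<lambda>\<omega>. (U \<omega>)\<^sup>2) \<le> 4 * real (q (N j) + 1) * E (N j) \<and>
      expectation (\<lambda>\<omega>. \<bar>V \<omega>\<bar>) \<le> 4 * real (N j) * \<alpha> (q (N j))" for j U V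
    have "\<exists>U V. P j U V" for j
      unfolding P_def E_eq
      by (rule count_decomposition[where I = I and n = "N j", OF I le_add1[of "q (N j)" 1]])
         (assumption, intro exI conjI, assumption+)
    then obtain U V where "\<And>j. P j (U j) (V j)" by metis
    then have UV: "\<And>j \<omega>. bc_count ?B (N j) \<omega> - E (N j) = U j \<omega> + V j \<omega>"
      "\<And>j. integrable M (\<lambda>\<omega>. (U j \<omega>)\<^sup>2)" "\<And>j. integrable M (V j)"
      "\<And>j. expectation (\<lambda>\<omega>. (U j \<omega>)\<^sup>2) \<le> 4 * real (q (N j) + 1) * E (N j)"
      "\<And>j. expectation (\<lambda>\<omega>. \<bar>V j \<omega>\<bar>) \<le> 4 * real (N j) * \<alpha> (q (N j))"
      unfolding P_def by auto
    have s: "summable (\<lambda>j. 4 * v (N j))" using NJ(1) by simp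
    have "AE \<omega> in M. (\<lambda>j. (U j \<omega>)\<^sup>2 / (E (N j))\<^sup>2) \<longlonglongrightarrow> 0"
    proof (rule AE_tendsto_zero_of_summable_integrals[OF _ _ _ s])
      fix j
      have "(\<integral>\<omega>. (U j \<omega>)\<^sup>2 / (E (N j))\<^sup>2 \<partial>M) \<le> 4 * real (q (N j) + 1) * E (N j) / (E (N j))\<^sup>2"
        using UV(4)[of j] by (simp add: divide_right_mono)
      also have "\<dots> = 4 * ((real (q (N j)) + 1) / E (N j))"
        using EN[of j] by (simp add: power2_eq_square)
      also have "\<dots> \<le> 4 * v (N j)" using NJ(4)[of j] u by (simp add: v_def)
      finally show "(\<integral>\<omega>. (U j \<omega>)\<^sup>2 / (E (N j))\<^sup>2 \<partial>M) \<le> 4 * v (N j)" .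
    qed (use UV(2) in auto)
    moreover have "AE \<omega> in M. (\<lambda>j. \<bar>V j \<omega>\<bar> / E (N j)) \<longlonglongrightarrow> 0"
    proof (rule AE_tendsto_zero_of_summable_integrals[OF _ _ _ s])
      fix j
      have N: "0 < real (N j)" using NJ(4) by simp
      have "(\<integral>\<omega>. \<bar>V j \<omega>\<bar> / E (N j) \<partial>M) \<le> 4 * real (N j) * \<alpha> (q (N j)) / E (N j)"
        using UV(5)[of j] EN[of j] by (simp add: divide_right_mono)
      also have "\<dots> \<le> 4 * real (N j) * (E (N j) * u (N j) / real (N j)) / E (N j)"
        using mix[OF NJ(4)[of j] NJ(5)[of j]] EN[of j] by (intro divide_right_mono mult_left_mono) auto
      also have "\<dots> = 4 * u (N j)" using EN[of j] N by simp
      also have "\<dots> \<le> 4 * v (N j)" using NJ(4)[of j] EN[of j] by (simp add: v_def)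
      finally show "(\<integral>\<omega>. \<bar>V j \<omega>\<bar> / E (N j) \<partial>M) \<le> 4 * v (N j)" .
    qed (use UV(3) EN in \<open>auto simp: less_imp_le\<close>)
    ultimately show ?thesis
    proof eventually_elim
      case (elim \<omega>)
      have "(\<lambda>j. sqrt ((U j \<omega>)\<^sup>2 / (E (N j))\<^sup>2)) \<longlonglongrightarrow> sqrt 0"
        by (intro tendsto_intros elim(1))
      then have "(\<lambda>j. \<bar>U j \<omega> / E (N j)\<bar>) \<longlonglongrightarrow> 0" by (simp add: real_sqrt_divide)
      then have 1: "(\<lambda>j. U j \<omega> / E (N j)) \<longlonglongrightarrow> 0" by (rule tendsto_rabs_zero_cancel)
      have "(\<lambda>j. \<bar>V j \<omega> / E (N j)\<bar>) \<longlonglongrightarrow> 0"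
        using elim(2) EN by (simp add: less_imp_le)
      then have 2: "(\<lambda>j. V j \<omega> / E (N j)) \<longlonglongrightarrow> 0" by (rule tendsto_rabs_zero_cancel)
      have "(\<lambda>j. 1 + (U j \<omega> / E (N j) + V j \<omega> / E (N j))) \<longlonglongrightarrow> 1 + (0 + 0)"
        by (intro tendsto_intros 1 2)
      moreover have "1 + (U j \<omega> / E (N j) + V j \<omega> / E (N j)) = bc_count ?B (N j) \<omega> / E (N j)" for j
        using EN[of j] UV(1)[of j \<omega>] by (simp add: field_simps)
      ultimately have lim: "(\<lambda>j. bc_count ?B (N j) \<omega> / E (N j)) \<longlonglongrightarrow> 1" by simp
      have "mono (\<lambda>n. bc_count ?B n \<omega>)"
        unfolding bc_count_def by (intro monoI sum_mono2) auto
      from ratio_sandwich[OF E_mono E_top this c NJ(2,3) lim] show ?case .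
    qed
  qed
  have "AE \<omega> in M. \<forall>i. \<forall>\<^sub>F n in sequentially.
      1 / (1 + 1 / real (Suc i)) ^ 3 \<le> bc_count ?B n \<omega> / E n \<and>
      bc_count ?B n \<omega> / E n \<le> (1 + 1 / real (Suc i)) ^ 3"
    unfolding AE_all_countable by (intro allI AE_c) simp
  then have "AE \<omega> in M. (\<lambda>n. bc_count ?B n \<omega> / E n) \<longlonglongrightarrow> 1"
    by eventually_elim (intro tendsto_1_of_ratio_bounds, blast)
  then show ?thesis
    unfolding strongly_borel_cantelli_seq_def mean using div by (simp add: prob_interval_event I)
qed

end

section \<open>Thinning\<close>

context stationary_sequence
begin

text \<open>If the claim failed, all the decreasing events \<open>G N\<close> would have probability
  above \<epsilon>, and each time in \<open>T\<close> would remove a fixed proportion of its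
  marginal. The removed total is at most 1, contradicting divergence along \<open>T\<close>.\<close>

lemma avoidance_probability_le:
  assumes I: "\<And>k. k > 0 \<Longrightarrow> is_interval (I k)" and \<epsilon>: "0 < \<epsilon>"
    and T_pos: "\<forall>N\<in>T. 1 \<le> N"
    and T_gap: "\<forall>N\<in>T. \<exists>g. \<alpha> g \<le> \<epsilon> / 4 * marginal (I N) \<and> (\<forall>M\<in>T. M < N \<longrightarrow> M + g \<le> N)"
    and T_div: "\<not> summable (\<lambda>N. if N \<in> T then marginal (I N) else 0)"
  shows "prob {\<omega> \<in> space M. \<forall>n\<in>T. K \<le> n \<longrightarrow> X (int n) \<omega> \<notin> I n} \<le> \<epsilon>"
proof (rule ccontr)
  define G where "G N = {\<omega> \<in> space M. \<forall>n\<in>T. K \<le> n \<and> n \<le> N \<longrightarrow> X (int n) \<omega> \<notin> I n}" for N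
  let ?B = "\<lambda>n. {\<omega> \<in> space M. X (int n) \<omega> \<in> I n}"
  let ?Q = "prob {\<omega> \<in> space M. \<forall>n\<in>T. K \<le> n \<longrightarrow> X (int n) \<omega> \<notin> I n}"
  assume "\<not> ?Q \<le> \<epsilon>"
  then have Q: "\<epsilon> < ?Q" by simp
  have B [measurable]: "?B n \<in> sets M" if "n \<in> T" for n
    using bspec[OF T_pos that] by (intro events_interval I) auto
  have G_alt: "G N = space M - (\<Union>n\<in>{n\<in>T. K \<le> n \<and> n \<le> N}. ?B n)" for N
    unfolding G_def by auto
  have fin: "finite {n\<in>T. K \<le> n \<and> n \<le> N}" for N
    by (rule finite_subset[of _ "{..N}"]) auto
  have G_meas [measurable]: "G N \<in> sets M" for N
    unfolding G_alt using fin B by (intro sets.Diff sets.finite_UN sets.top) auto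
  have Q_le: "?Q \<le> prob (G N)" for N
    by (rule finite_measure_mono) (auto simp: G_def)
  define f where "f N = (if N \<in> T then marginal (I N) else 0)" for N
  have f_nonneg: "0 \<le> f N" for N by (simp add: f_def marginal_nonneg)
  \<comment> \<open>By the gap condition \<open>G N\<close> lies in the past at lag
    \<open>g\<close>, so the removed part is at least \<open>\<epsilon> * f (Suc N)\<close> minus
    \<open>2 * \<alpha> g\<close>. The factor \<open>\<epsilon> / 4\<close> in the gap condition
    leaves one half.\<close>
  have step: "\<epsilon> / 2 * f (Suc N) \<le> prob (G N) - prob (G (Suc N))" if "K \<le> N" for N
  proof (cases "Suc N \<in> T")
    case True
    obtain g where g: "\<alpha> g \<le> \<epsilon> / 4 * marginal (I (Suc N))"
      "\<And>M. M \<in> T \<Longrightarrow> M < Suc N \<Longrightarrow> M + g \<le> Suc N"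
      using bspec[OF T_gap True] by blast
    let ?m = "int (Suc N) - int g"
    have "?B n \<in> sets (past ?m)" if n: "n \<in> T" "n \<le> N" for n
    proof -
      have "int n \<le> ?m" using g(2)[of n] n by simp
      then have "X (int n) \<in> borel_measurable (past ?m)" by (rule X_past)
      then have "X (int n) -` I n \<inter> space (past ?m) \<in> sets (past ?m)"
        by (rule measurable_sets) (use bspec[OF T_pos n(1)] in \<open>auto intro!: real_interval_borel_measurable I\<close>)
      then show ?thesis by (simp add: vimage_def Int_def conj_commute)
    qed
    moreover have "space M \<in> sets (past ?m)"
      using sets.top[of "past ?m"] by simp
    ultimately have "G N \<in> sets (past ?m)"
      unfolding G_alt using fin by (intro sets.Diff sets.finite_UN) auto
    then have mix: "\<bar>prob (G N \<inter> ?B (Suc N)) - prob (G N) * marginal (I (Suc N))\<bar> \<le> 2 * \<alpha> g"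
      by (intro mixing_interval I) auto
    have "G (Suc N) = G N - G N \<inter> ?B (Suc N)"
      unfolding G_def using True \<open>K \<le> N\<close> by (auto simp: le_Suc_eq)
    then have "prob (G (Suc N)) = prob (G N) - prob (G N \<inter> ?B (Suc N))"
      using B[OF True] by (simp add: finite_measure_Diff)
    moreover have "\<epsilon> * marginal (I (Suc N)) \<le> prob (G N) * marginal (I (Suc N))"
      using Q Q_le[of N] by (intro mult_right_mono marginal_nonneg) simp
    ultimately show ?thesis using mix g(1) True by (simp add: f_def)
  next
    case False
    then have "G (Suc N) = G N" unfolding G_def by (auto simp: le_Suc_eq)
    then show ?thesis using False by (simp add: f_def)
  qed
  have "summable (\<lambda>j. f (j + Suc K))"
  proof (rule bounded_imp_summable)
    show "(\<Sum>j\<le>n. f (j + Suc K)) \<le> 2 / \<epsilon>" for n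
    proof -
      have "\<epsilon> / 2 * (\<Sum>j\<le>n. f (j + Suc K)) \<le> prob (G K) - prob (G (Suc n + K))"
      proof (induction n)
        case 0
        then show ?case using step[of K] by simp
      next
        case (Suc n)
        then show ?case using step[of "Suc n + K"] by (simp add: distrib_left)
      qed
      also have "\<dots> \<le> 1" using measure_nonneg[of M "G (Suc n + K)"] prob_le_1[of "G K"] by linarith
      finally show ?thesis using \<epsilon> by (simp add: field_simps)
    qed
  qed (rule f_nonneg)
  then have "summable f" by (subst (asm) summable_iff_shift)
  with T_div show False by (simp add: f_def[abs_def])
qed

text \<open>Avoiding all late events implies avoiding those at times in \<open>T\<close>, which has
  probability at most \<epsilon>. Since \<open>T\<close> may depend on \<epsilon>, the avoidance
  probability is 0.\<close>

lemma borel_cantelli_of_thinnings: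
  assumes I: "\<And>k. k > 0 \<Longrightarrow> is_interval (I k)"
    and thin: "\<And>\<epsilon>. 0 < \<epsilon> \<Longrightarrow> \<exists>T. (\<forall>N\<in>T. 1 \<le> N) \<and>
      (\<forall>N\<in>T. \<exists>g. \<alpha> g \<le> \<epsilon> * marginal (I N) \<and> (\<forall>M\<in>T. M < N \<longrightarrow> M + g \<le> N)) \<and>
      \<not> summable (\<lambda>N. if N \<in> T then marginal (I N) else 0)"
  shows "borel_cantelli_seq M (\<lambda>k. {\<omega> \<in> space M. X (int k) \<omega> \<in> I k})"
proof -
  let ?B = "\<lambda>k. {\<omega> \<in> space M. X (int k) \<omega> \<in> I k}"
  have B [measurable]: "?B n \<in> sets M" if "0 < n" for n by (intro events_interval I that)
  \<comment> \<open>Starting at \<open>Suc K\<close> excludes time 0, where the event need not be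
    measurable.\<close>
  define A where "A K = {\<omega> \<in> space M. \<forall>n\<ge>Suc K. X (int n) \<omega> \<notin> I n}" for K
  have A_alt: "A K = space M - (\<Union>n\<in>{Suc K..}. ?B n)" for K by (auto simp: A_def)
  have A_meas: "A K \<in> sets M" for K
    unfolding A_alt by (intro sets.Diff sets.top sets.countable_UN') auto
  have le: "prob (A K) \<le> \<epsilon>" if "0 < \<epsilon>" for \<epsilon> K
  proof -
    have "0 < \<epsilon> / 4" using that by simp
    from thin[OF this] obtain T where T: "\<forall>N\<in>T. 1 \<le> N"
      "\<forall>N\<in>T. \<exists>g. \<alpha> g \<le> \<epsilon> / 4 * marginal (I N) \<and> (\<forall>M\<in>T. M < N \<longrightarrow> M + g \<le> N)"
      "\<not> summable (\<lambda>N. if N \<in> T then marginal (I N) else 0)"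
      by (elim exE conjE)
    let ?S = "{\<omega> \<in> space M. \<forall>n\<in>T. Suc K \<le> n \<longrightarrow> X (int n) \<omega> \<notin> I n}"
    have "?S = space M - (\<Union>n\<in>{n\<in>T. Suc K \<le> n}. ?B n)" by auto
    also have "\<dots> \<in> sets M" by (intro sets.Diff sets.top sets.countable_UN') auto
    finally have "prob (A K) \<le> prob ?S"
      by (intro finite_measure_mono) (auto simp: A_def)
    also have "\<dots> \<le> \<epsilon>" by (rule avoidance_probability_le[OF I that T])
    finally show ?thesis .
  qed
  have "prob (A K) \<le> 0" for K
    by (rule field_le_epsilon) (simp add: le[of _ K])
  then have "prob (A K) = 0" for K
    using measure_nonneg[of M "A K"] by (intro order_antisym)
  then have "A K \<in> null_sets M" for K
    using A_meas by (intro null_setsI) (simp_all add: emeasure_eq_measure)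
  then have "AE \<omega> in M. \<forall>K. \<omega> \<notin> A K"
    unfolding AE_all_countable by (intro allI AE_not_in) auto
  then have ae: "AE \<omega> in M. \<omega> \<in> limsup ?B"
  proof (rule AE_mp, intro AE_I2 impI)
    fix \<omega> assume \<omega>: "\<omega> \<in> space M" "\<forall>K. \<omega> \<notin> A K"
    have "\<exists>n\<ge>K. \<omega> \<in> ?B n" for K
    proof -
      obtain n where "Suc K \<le> n" "X (int n) \<omega> \<in> I n" using \<omega> unfolding A_def by blast
      then show ?thesis using \<omega>(1) by (intro exI[of _ n]) auto
    qed
    then show "\<omega> \<in> limsup ?B" by (auto simp: limsup_INF_SUP)
  qed
  have "limsup ?B = (\<Inter>K. \<Union>n\<in>{Suc K..}. ?B n)"
    unfolding limsup_INF_SUP by (auto simp: Suc_le_eq) (metis Suc_leD atLeast_iff)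
  also have "\<dots> \<in> sets M"
    by (intro sets.countable_INT' sets.countable_UN') auto
  finally have "limsup ?B \<in> sets M" .
  with ae show ?thesis unfolding borel_cantelli_seq_def by (simp add: prob_eq_1)
qed

text \<open>Reduces to \<open>thinning\<close>. The \<open>LEAST\<close> stands for the generalized
  inverse of \<open>as\<close>, with value 1 where the inverse is 0, which makes it a usable step
  length.\<close>

lemma borel_cantelli_of_halving_rate:
  fixes as :: "nat \<Rightarrow> real"
  assumes I: "\<And>k. k > 0 \<Longrightarrow> is_interval (I k)"
    and div: "\<not> summable (\<lambda>k. marginal (I (Suc k)))"
    and mono: "antimono_on {1..} (\<lambda>n. marginal (I n))"
    and as: "antimono as" and C: "0 < C" and \<delta>: "0 < \<delta>"
    and rate: "\<And>n. n0 \<le> n \<Longrightarrow> \<alpha> n \<le> C * as n \<and> as (2 * n) \<le> (1 - \<delta>) * as n"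
    and L_div: "\<not> summable (\<lambda>k. marginal (I (Suc k)) /
      real (LEAST l. 1 \<le> l \<and> as l \<le> marginal (I (Suc k))))"
  shows "borel_cantelli_seq M (\<lambda>k. {\<omega> \<in> space M. X (int k) \<omega> \<in> I k})"
proof (rule borel_cantelli_of_thinnings[OF I])
  fix \<epsilon> :: real assume \<epsilon>: "0 < \<epsilon>"
  let ?m = "\<lambda>n. marginal (I n)"
  \<comment> \<open>From \<open>n0\<close> on, \<open>as\<close> dominates a positive multiple of
    \<alpha>; monotonicity carries the sign to earlier indices.\<close>
  have "0 \<le> as n" if "n0 \<le> n" for n
    using rate[OF that] alpha_nonneg[of n] C by (meson order_trans zero_le_mult_iff not_less)
  then have as_nonneg: "0 \<le> as n" for n
    using antimonoD[OF as, of n "max n n0"] by (metis max.cobounded1 max.cobounded2 order_trans)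
  have m_mono: "?m j \<le> ?m i" if "1 \<le> i" "i \<le> j" for i j
    using mono that by (auto simp: monotone_on_def)
  \<comment> \<open>A vanishing marginal would make all later ones vanish, and the series would
    converge.\<close>
  have m_pos: "0 < ?m n" if "1 \<le> n" for n
  proof (rule ccontr)
    assume "\<not> ?thesis"
    then have "?m n = 0" using marginal_nonneg[of "I n"] by simp
    then have zero: "?m (Suc k) = 0" if "n \<le> k" for k
      using m_mono[of n "Suc k"] \<open>1 \<le> n\<close> that marginal_nonneg[of "I (Suc k)"] by simp
    have "summable (\<lambda>k. ?m (Suc k))"
      by (rule summable_finite[of "{..n}"]) (auto simp: zero)
    with div show False by simp
  qed
  \<comment> \<open>The maximum keeps \<rho> positive even if
    \<open>\<delta> \<ge> 1\<close>.\<close>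
  define \<rho> where "\<rho> = max (1 - \<delta>) (1 / 2)"
  have \<rho>: "0 < \<rho>" "\<rho> < 1" using \<delta> by (auto simp: \<rho>_def)
  have halving: "as (2 * n) \<le> \<rho> * as n" if "n0 \<le> n" for n
    using rate[OF that] as_nonneg[of n] mult_right_mono[of "1 - \<delta>" \<rho> "as n"] by (simp add: \<rho>_def)
  have a_le: "\<alpha> n \<le> C * as n" if "n0 \<le> n" for n using rate[OF that] by simp
  have d: "\<not> summable (\<lambda>n. ?m n / real (LEAST l. 1 \<le> l \<and> as l \<le> ?m n))"
    using L_div summable_Suc_iff[of "\<lambda>n. ?m n / real (LEAST l. 1 \<le> l \<and> as l \<le> ?m n)"] by simp
  show "\<exists>T. (\<forall>N\<in>T. 1 \<le> N) \<and>
      (\<forall>N\<in>T. \<exists>g. \<alpha> g \<le> \<epsilon> * ?m N \<and> (\<forall>M\<in>T. M < N \<longrightarrow> M + g \<le> N)) \<and>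
      \<not> summable (\<lambda>N. if N \<in> T then ?m N else 0)"
    by (rule thinning[where a = \<alpha> and as = as and m = ?m and C = C and \<rho> = \<rho> and \<epsilon> = \<epsilon>,
        OF as as_nonneg a_le halving \<rho> C m_mono marginal_nonneg m_pos \<epsilon> d])
qed

end

section \<open>Explicit rates\<close>

text \<open>A finite value is the infimum of a nonempty set of naturals, hence one of its
  elements.\<close>

lemma seq_inverse_attained:
  assumes "seq_inverse v u \<noteq> \<infinity>"
  shows "v (the_enat (seq_inverse v u)) \<le> u"
proof -
  have ne: "enat ` {n. v n \<le> u} \<noteq> {}"
  proof
    assume "enat ` {n. v n \<le> u} = {}"
    then have "seq_inverse v u = \<infinity>" unfolding seq_inverse_def by (simp add: Inf_enat_def)
    with assms show False by simp
  qed
  then have "\<exists>x. x \<in> enat ` {n. v n \<le> u}" by blast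
  then have "seq_inverse v u \<in> enat ` {n. v n \<le> u}"
    unfolding seq_inverse_def Inf_enat_def if_not_P[OF ne] by (rule LeastI_ex)
  then show ?thesis by auto
qed

text \<open>
  If no \<open>l\<close> qualifies, the left-hand side is \<open>0\<close>, so the unspecified value of \<open>LEAST\<close> does no harm.
\<close>

lemma divide_seq_inverse_le:
  assumes "0 \<le> m"
  shows "(if seq_inverse v u = 0 then 0 else ennreal m / ennreal_of_enat (seq_inverse v u))
    \<le> ennreal (m / real (LEAST l. 1 \<le> l \<and> v l \<le> u))"
proof (cases "seq_inverse v u")
  case (enat n)
  show ?thesis
  proof (cases "n = 0")
    case False
    let ?L = "LEAST l. 1 \<le> l \<and> v l \<le> u"
    have n: "1 \<le> n \<and> v n \<le> u" using seq_inverse_attained[of v u] enat False by simp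
    then have L: "1 \<le> ?L" "?L \<le> n"
      using LeastI[of "\<lambda>l. 1 \<le> l \<and> v l \<le> u" n] by (auto intro: Least_le)
    have "ennreal m / ennreal_of_enat (seq_inverse v u) = ennreal (m / real n)"
      using n assms by (simp add: enat ennreal_of_nat_eq_real_of_nat divide_ennreal)
    also have "\<dots> \<le> ennreal (m / real ?L)"
      using L assms by (intro ennreal_leI divide_left_mono) auto
    finally show ?thesis by simp
  qed (simp add: enat zero_enat_def)
qed simp

text \<open>The lag \<open>q\<close> of order \<open>n powr (1 / (a + 1))\<close> balances the two
  error terms \<open>q\<close> and \<open>n * q powr (- a)\<close>, which both become of order
  \<open>r\<close>. Rounding up at most doubles \<open>r\<close>, because
  \<open>r \<ge> 1\<close>.\<close>

lemma powr_lag: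
  fixes a :: real
  assumes a: "0 < a" and n: "1 \<le> n"
  defines "r \<equiv> real n powr (1 / (a + 1))"
  defines "q \<equiv> nat \<lceil>r\<rceil>"
  shows "1 \<le> q" "real q \<le> 2 * r" "real q powr (- a) \<le> r / real n"
proof -
  have r: "1 \<le> r" unfolding r_def using a n by (intro ge_one_powr_ge_zero) auto
  have rq: "r \<le> real q" unfolding q_def by (rule real_nat_ceiling_ge)
  then show "1 \<le> q" using r by linarith
  have "real q \<le> r + 1" unfolding q_def using r by linarith
  then show "real q \<le> 2 * r" using r by simp
  have "real q powr (- a) \<le> r powr (- a)"
    using rq r a by (intro powr_mono2') auto
  also have "\<dots> = real n powr (1 / (a + 1) - 1)"
    unfolding r_def powr_powr using a by (intro arg_cong2[where f = "(powr)"]) (auto simp: field_simps)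
  also have "\<dots> = r / real n" using n by (simp add: r_def powr_diff)
  finally show "real q powr (- a) \<le> r / real n" .
qed

section \<open>Lags obtained from \<eta> and from power rates\<close>

context stationary_sequence
begin

text \<open>A point \<open>x\<close> within 1 of the infimum defining the inverse of \<eta> gives
  the lag \<open>l\<close>, its integer part: both \<open>l\<close> and
  \<open>n * \<alpha> l\<close> are at most \<open>x\<close>. The extra 1 disappears since
  \<open>E\<close> tends to infinity.\<close>

lemma L1_borel_cantelli_of_eta:
  assumes I: "\<And>k. k > 0 \<Longrightarrow> is_interval (I k)"
  defines "E \<equiv> \<lambda>n. \<Sum>k=1..n. marginal (I k)"
  assumes div: "\<not> summable (\<lambda>k. marginal (I (Suc k)))"
    and lim: "(\<lambda>n. pos_inverse (\<lambda>x. \<alpha> (nat \<lfloor>x\<rfloor>) / x) (1 / real n) / E n) \<longlonglongrightarrow> 0"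
  shows "L1_borel_cantelli_seq M (\<lambda>k. {\<omega> \<in> space M. X (int k) \<omega> \<in> I k})"
proof -
  define \<eta> where "\<eta> n = pos_inverse (\<lambda>x. \<alpha> (nat \<lfloor>x\<rfloor>) / x) (1 / real n)" for n
  have E_top: "filterlim E at_top sequentially"
    unfolding E_def by (intro filterlim_partial_sums_at_top marginal_nonneg div)
  have E_eq: "E n = (\<Sum>k=1..n. marginal (I k))" for n by (simp add: E_def)
  have E_nonneg: "0 \<le> E n" for n unfolding E_def by (intro sum_nonneg marginal_nonneg)
  have "\<exists>l. real l \<le> \<eta> n + 1 \<and> real n * \<alpha> l \<le> \<eta> n + 1" if n: "1 \<le> n" for n
  proof -
    let ?P = "{x. x > 0 \<and> \<alpha> (nat \<lfloor>x\<rfloor>) / x \<le> 1 / real n}"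
    \<comment> \<open>Since \<alpha> is at most 1, the point \<open>n\<close> shows that the infimum
      is over a nonempty set.\<close>
    have "real n \<in> ?P" using n alpha_le_1[of n] by (simp add: divide_right_mono)
    then have "?P \<noteq> {}" by blast
    then obtain x where x: "x \<in> ?P" "x < \<eta> n + 1"
      using cInf_lessD[of ?P "\<eta> n + 1"] unfolding \<eta>_def pos_inverse_def by auto
    then have "real (nat \<lfloor>x\<rfloor>) \<le> x" by simp
    moreover have "real n * \<alpha> (nat \<lfloor>x\<rfloor>) \<le> x"
      using x n by (auto simp: divide_le_eq field_simps)
    ultimately show ?thesis using x(2) by (intro exI[of _ "nat \<lfloor>x\<rfloor>"]) simp
  qed
  then obtain l where l: "\<And>n. 1 \<le> n \<Longrightarrow> real (l n) \<le> \<eta> n + 1"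
    "\<And>n. 1 \<le> n \<Longrightarrow> real n * \<alpha> (l n) \<le> \<eta> n + 1"
    by metis
  have "(\<lambda>n. \<eta> n / E n + 1 / E n) \<longlonglongrightarrow> 0 + 0"
    using lim unfolding \<eta>_def[symmetric]
    by (intro tendsto_add real_tendsto_divide_at_top[OF tendsto_const E_top])
  then have bound: "(\<lambda>n. (\<eta> n + 1) / E n) \<longlonglongrightarrow> 0" by (simp add: add_divide_distrib)
  show ?thesis
  proof (rule L1_borel_cantelli_of_lags[where l = l and q = l, OF I div], unfold E_eq[symmetric])
    show "(\<lambda>n. real (l n) / E n) \<longlonglongrightarrow> 0"
      by (rule tendsto_sandwich[OF _ _ tendsto_const bound])
        (auto simp: E_nonneg eventually_sequentially intro!: exI[of _ 1] divide_right_mono l)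
    show "(\<lambda>n. real n * \<alpha> (l n) / E n) \<longlonglongrightarrow> 0"
      by (rule tendsto_sandwich[OF _ _ tendsto_const bound])
        (auto simp: E_nonneg alpha_nonneg eventually_sequentially intro!: exI[of _ 1] divide_right_mono l)
  qed auto
qed

text \<open>For \<open>as n = n powr (- a)\<close> the inverse at \<open>m\<close> is of order
  \<open>m powr (- 1 / a)\<close>, so \<open>m\<close> divided by it is of order
  \<open>m powr ((a + 1) / a)\<close>. Doubling the index multiplies \<open>as\<close> by exactly
  \<open>2 powr (- a)\<close>.\<close>

lemma borel_cantelli_of_powr_rate:
  fixes a K :: real
  assumes I: "\<And>k. k > 0 \<Longrightarrow> is_interval (I k)" and a: "0 < a" and K: "0 < K"
    and div: "\<not> summable (\<lambda>k. marginal (I (Suc k)))"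
    and rate: "\<And>n. 1 \<le> n \<Longrightarrow> \<alpha> n \<le> K * real n powr (- a)"
    and mono: "antimono_on {1..} (\<lambda>n. marginal (I n))"
    and powr_div: "\<not> summable (\<lambda>k. marginal (I (Suc k)) powr ((a + 1) / a))"
  shows "borel_cantelli_seq M (\<lambda>k. {\<omega> \<in> space M. X (int k) \<omega> \<in> I k})"
proof -
  \<comment> \<open>As \<open>0 powr (- a) = 0\<close>, the value at 0 must be set by hand for
    \<open>as\<close> to be non-increasing.\<close>
  define as where "as n = (if n = 0 then 1 else real n powr (- a))" for n :: nat
  let ?m = "\<lambda>k. marginal (I (Suc k))"
  let ?L = "\<lambda>k. LEAST l. 1 \<le> l \<and> as l \<le> ?m k"
  have as: "antimono as"
  proof (rule antimonoI)
    fix i j :: nat assume "i \<le> j"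
    then show "as j \<le> as i"
      using a powr_mono2'[of "- a" 1 "real j"] powr_mono2'[of "- a" "real i" "real j"]
      by (auto simp: as_def)
  qed
  have ev: "\<alpha> n \<le> K * as n \<and> as (2 * n) \<le> (1 - (1 - 2 powr (- a))) * as n" if "1 \<le> n" for n
    using rate[OF that] that by (simp add: as_def powr_mult)
  have "?m k powr ((a + 1) / a) \<le> 2 * (?m k / real (?L k))" for k
  proof (cases "?m k = 0")
    case False
    then have m: "0 < ?m k" "?m k \<le> 1"
      using marginal_nonneg[of "I (Suc k)"] marginal_le_1[of "I (Suc k)"] by auto
    \<comment> \<open>The solution of \<open>x powr (- a) = ?m k\<close>. It is at least 1 because
      marginals are at most 1, so rounding up at most doubles it.\<close>
    define x where "x = ?m k powr (- 1 / a)"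
    have x: "1 \<le> x"
      using powr_mono2'[of "- 1 / a" "?m k" 1] m a by (simp add: x_def divide_simps)
    let ?l = "nat \<lceil>x\<rceil>"
    have l: "x \<le> real ?l" "real ?l \<le> 2 * x" using x by linarith+
    have l1: "1 \<le> ?l" using l x by linarith
    have "real ?l powr (- a) \<le> x powr (- a)" using l x a by (intro powr_mono2') auto
    also have "\<dots> = ?m k" unfolding x_def powr_powr using m a by simp
    finally have ok: "1 \<le> ?l \<and> as ?l \<le> ?m k" using l1 unfolding as_def by auto
    then have "?L k \<le> ?l" "1 \<le> ?L k"
      using LeastI[of "\<lambda>l. 1 \<le> l \<and> as l \<le> ?m k", OF ok] by (auto intro: Least_le)
    with l have Lx: "0 < real (?L k)" "real (?L k) \<le> 2 * x" by linarith+
    have "?m k powr ((a + 1) / a) * x = ?m k powr ((a + 1) / a + - 1 / a)"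
      unfolding x_def by (rule powr_add[symmetric])
    also have "(a + 1) / a + - 1 / a = 1" using a by (simp add: field_simps)
    finally have "?m k powr ((a + 1) / a) * x = ?m k" using m by simp
    moreover have "?m k powr ((a + 1) / a) * real (?L k) \<le> ?m k powr ((a + 1) / a) * (2 * x)"
      using Lx by (intro mult_left_mono) auto
    ultimately show ?thesis using Lx by (simp add: field_simps)
  qed simp
  then have "summable (\<lambda>k. ?m k powr ((a + 1) / a))" if "summable (\<lambda>k. ?m k / real (?L k))"
    using that by (intro summable_comparison_test'[OF summable_mult[OF that, of 2], of 0]) simp
  with powr_div have L_div: "\<not> summable (\<lambda>k. ?m k / real (?L k))" by blast
  have "2 powr (- a) < (1::real)" using a powr_less_mono[of "- a" 0 2] by simp
  then have \<delta>: "0 < 1 - 2 powr (- a)" by simp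
  show ?thesis
    by (rule borel_cantelli_of_halving_rate[OF I div mono as K \<delta> ev L_div])
qed

text \<open>With the balanced lag both errors are at most a constant times \<open>r n / E n\<close>,
  which is the reciprocal of the quantity assumed to diverge.\<close>

lemma L1_borel_cantelli_of_powr_rate:
  fixes a K :: real
  assumes I: "\<And>k. k > 0 \<Longrightarrow> is_interval (I k)" and a: "0 < a" and K: "0 < K"
  defines "E \<equiv> \<lambda>n. \<Sum>k=1..n. marginal (I k)"
  assumes div: "\<not> summable (\<lambda>k. marginal (I (Suc k)))"
    and rate: "\<And>n. 1 \<le> n \<Longrightarrow> \<alpha> n \<le> K * real n powr (- a)"
    and lim: "filterlim (\<lambda>n. real n powr (- 1 / (a + 1)) * E n) at_top sequentially"
  shows "L1_borel_cantelli_seq M (\<lambda>k. {\<omega> \<in> space M. X (int k) \<omega> \<in> I k})"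
proof -
  define r where "r n = real n powr (1 / (a + 1))" for n
  define q where "q n = nat \<lceil>r n\<rceil>" for n
  note lag = powr_lag[OF a, folded r_def, folded q_def]
  have E_eq: "E n = (\<Sum>k=1..n. marginal (I k))" for n by (simp add: E_def)
  have E_nonneg: "0 \<le> E n" for n unfolding E_def by (intro sum_nonneg marginal_nonneg)
  have "(\<lambda>n. inverse (real n powr (- 1 / (a + 1)) * E n)) \<longlonglongrightarrow> 0"
    by (rule tendsto_inverse_0_at_top[OF lim])
  moreover have "inverse (real n powr (- 1 / (a + 1)) * E n) = r n / E n" for n
    by (simp add: r_def powr_minus divide_inverse)
  ultimately have rE: "(\<lambda>n. r n / E n) \<longlonglongrightarrow> 0" by simp
  have lim': "(\<lambda>n. c * (r n / E n)) \<longlonglongrightarrow> 0" for c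
    using tendsto_mult_right_zero[OF rE] .
  show ?thesis
  proof (rule L1_borel_cantelli_of_lags[where l = q and q = q, OF I div], unfold E_eq[symmetric])
    have "real (q n) / E n \<le> 2 * (r n / E n)" if "1 \<le> n" for n
      using divide_right_mono[OF lag(2)[OF that] E_nonneg[of n]] by simp
    then show "(\<lambda>n. real (q n) / E n) \<longlonglongrightarrow> 0"
      by (intro tendsto_sandwich[OF _ _ tendsto_const lim'[of 2]])
        (auto simp: E_nonneg eventually_sequentially intro!: exI[of _ 1])
    have "real n * \<alpha> (q n) / E n \<le> K * (r n / E n)" if n: "1 \<le> n" for n
    proof -
      have "\<alpha> (q n) \<le> K * (r n / real n)"
        using rate[OF lag(1)[OF n]] mult_left_mono[OF lag(3)[OF n], of K] K by simp
      then have "real n * \<alpha> (q n) \<le> K * r n" using n by (simp add: field_simps)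
      from divide_right_mono[OF this E_nonneg[of n]] show ?thesis by simp
    qed
    then show "(\<lambda>n. real n * \<alpha> (q n) / E n) \<longlonglongrightarrow> 0"
      by (intro tendsto_sandwich[OF _ _ tendsto_const lim'[of K]])
        (auto simp: E_nonneg alpha_nonneg eventually_sequentially intro!: exI[of _ 1])
  qed auto
qed

lemma strongly_borel_cantelli_of_powr_rate:
  fixes a K :: real
  assumes I: "\<And>k. k > 0 \<Longrightarrow> is_interval (I k)" and a: "0 < a" and K: "0 < K"
  defines "E \<equiv> \<lambda>n. \<Sum>k=1..n. marginal (I k)"
  assumes pos: "0 < marginal (I 1)"
    and div: "\<not> summable (\<lambda>k. marginal (I (Suc k)))"
    and rate: "\<And>n. 1 \<le> n \<Longrightarrow> \<alpha> n \<le> K * real n powr (- a)"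
    and sum: "summable (\<lambda>k. real (Suc k) powr (1 / (a + 1)) * marginal (I (Suc k)) / (E (Suc k))\<^sup>2)"
  shows "strongly_borel_cantelli_seq M (\<lambda>k. {\<omega> \<in> space M. X (int k) \<omega> \<in> I k})"
proof -
  define r where "r n = real n powr (1 / (a + 1))" for n
  define q where "q n = nat \<lceil>r n\<rceil>" for n
  \<comment> \<open>Chosen so that \<open>E n * u n / n\<close> equals \<open>K * r n / n\<close>,
    the bound on \<alpha> at the balanced lag.\<close>
  define u where "u n = K * r n / E n" for n
  note lag = powr_lag[OF a, folded r_def, folded q_def]
  have E_eq: "E n = (\<Sum>k=1..n. marginal (I k))" for n by (simp add: E_def)
  have E_nonneg: "0 \<le> E n" for n unfolding E_def by (intro sum_nonneg marginal_nonneg)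
  have E_pos: "0 < E n" if "0 < n" for n
  proof -
    have "marginal (I 1) \<le> E n"
      unfolding E_def using that by (intro member_le_sum) (auto simp: marginal_nonneg)
    with pos show ?thesis by simp
  qed
  have r: "0 \<le> r n" for n by (simp add: r_def)
  let ?m = "\<lambda>k. marginal (I (Suc k))"
  have s: "summable (\<lambda>k. r (Suc k) * ?m k / (E (Suc k))\<^sup>2)"
    using sum by (simp add: r_def)
  show ?thesis
  proof (rule strongly_borel_cantelli_of_lags[where q = q and u = u, OF I pos div], unfold E_eq[symmetric])
    show "0 \<le> u n" for n using K r E_nonneg by (simp add: u_def)
    have "summable (\<lambda>k. K * (r (Suc k) * ?m k / (E (Suc k))\<^sup>2))"
      using s by (rule summable_mult)
    moreover have "K * (r (Suc k) * ?m k / (E (Suc k))\<^sup>2) = ?m k / E (Suc k) * u (Suc k)" for k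
      by (simp add: u_def power2_eq_square)
    ultimately show "summable (\<lambda>k. ?m k / E (Suc k) * u (Suc k))" by simp
    have "?m k / (E (Suc k))\<^sup>2 * real (q (Suc k)) \<le> 2 * (r (Suc k) * ?m k / (E (Suc k))\<^sup>2)" for k
    proof -
      have "?m k / (E (Suc k))\<^sup>2 * real (q (Suc k)) \<le> ?m k / (E (Suc k))\<^sup>2 * (2 * r (Suc k))"
        using lag(2)[of "Suc k"] by (intro mult_left_mono) (auto simp: marginal_nonneg)
      then show ?thesis by (simp add: ac_simps)
    qed
    then show "summable (\<lambda>k. ?m k / (E (Suc k))\<^sup>2 * real (q (Suc k)))"
      by (intro summable_comparison_test'[OF summable_mult[OF s, of 2], of 0])
        (simp add: marginal_nonneg)
    show "\<alpha> (q n) \<le> E n * u n / real n" if "0 < n" for n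
    proof -
      have n: "1 \<le> n" using that by simp
      have "\<alpha> (q n) \<le> K * (r n / real n)"
        using rate[OF lag(1)[OF n]] mult_left_mono[OF lag(3)[OF n], of K] K by simp
      also have "\<dots> = E n * u n / real n" using E_pos[OF that] by (simp add: u_def)
      finally show ?thesis .
    qed
  qed
qed

end

section \<open>Derivation of (A), (B1), (B2) and (C) from the criteria\<close>

theorem theorem4p2:
  fixes M :: "'a measure"
    and X :: "int \<Rightarrow> 'a \<Rightarrow> real"
    and \<mu> :: "real measure"
    and I :: "nat \<Rightarrow> real set"
    and B :: "nat \<Rightarrow> 'a set"
    and E :: "nat \<Rightarrow> real"
    and \<alpha> :: "nat \<Rightarrow> real"
  assumes "prob_space M"
    and "\<And>i. X i \<in> borel_measurable M"
    and "strictly_stationary M X"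
    and "\<And>i. distr M borel (X i) = \<mu>"
    and "\<And>k. k > 0 \<Longrightarrow> is_interval (I k)"
    and "measure \<mu> (I 1) > 0"
    and "\<not> summable (\<lambda>k. measure \<mu> (I (Suc k)))"
  defines "B \<equiv> (\<lambda>k. {\<omega> \<in> space M. X (int k) \<omega> \<in> I k})"
    and "E \<equiv> (\<lambda>n. \<Sum>k=1..n. measure \<mu> (I k))"
    and "\<alpha> \<equiv> alpha_inf1 M X"
  shows
    \<comment> \<open>(A)\<close>
    "(\<forall>\<alpha>s :: nat \<Rightarrow> real.
        antimono \<alpha>s \<and>
        (\<exists>n0 > (0::nat). \<exists>C > (0::real). \<exists>\<delta> > (0::real). \<forall>n\<ge>n0.
           \<alpha> n \<le> C * \<alpha>s n \<and> \<alpha>s (2 * n) \<le> (1 - \<delta>) * \<alpha>s n) \<and>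
        antimono_on {1..} (\<lambda>n. measure \<mu> (I n)) \<and>
        ((\<lambda>n. if \<alpha>s n = 0 then \<infinity> else ereal (measure \<mu> (I n) / \<alpha>s n)) \<longlonglongrightarrow> \<infinity>) \<and>
        (\<Sum>k. let m = measure \<mu> (I (Suc k)) in
             if seq_inverse \<alpha>s m = 0 then 0
             else ennreal m / ennreal_of_enat (seq_inverse \<alpha>s m)) = \<infinity>
        \<longrightarrow> borel_cantelli_seq M B)
     \<and>
     \<comment> \<open>(B1)\<close>
     (((\<lambda>n. pos_inverse (\<lambda>x. \<alpha> (nat \<lfloor>x\<rfloor>) / x) (1 / real n) / E n) \<longlonglongrightarrow> 0)
        \<longrightarrow> L1_borel_cantelli_seq M B)
     \<and>
     \<comment> \<open>(B2)\<close>
     ((\<exists>u :: nat \<Rightarrow> real.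
         (\<forall>n>0. u n > 0) \<and>
         summable (\<lambda>k. let n = Suc k in measure \<mu> (I n) / E n * u n) \<and>
         (\<Sum>k. let n = Suc k in
              ennreal (measure \<mu> (I n) / (E n)\<^sup>2) *
              ennreal_of_enat (seq_inverse \<alpha> (E n * u n / real n))) < \<infinity>)
        \<longrightarrow> strongly_borel_cantelli_seq M B)
     \<and>
     \<comment> \<open>(C)\<close>
     (\<forall>a > (0::real). (\<exists>C :: real. \<forall>n\<ge>1. \<alpha> n \<le> C * real n powr (- a)) \<longrightarrow>
        (\<not> summable (\<lambda>k. measure \<mu> (I (Suc k)) powr ((a + 1) / a)) \<and>
         filterlim (\<lambda>n. real n powr a * measure \<mu> (I n)) at_top sequentially \<and>
         antimono_on {1..} (\<lambda>n. measure \<mu> (I n))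
           \<longrightarrow> borel_cantelli_seq M B)
        \<and>
        (filterlim (\<lambda>n. real n powr (- 1 / (a + 1)) * E n) at_top sequentially
           \<longrightarrow> L1_borel_cantelli_seq M B)
        \<and>
        (summable (\<lambda>k. let n = Suc k in real n powr (1 / (a + 1)) * measure \<mu> (I n) / (E n)\<^sup>2)
           \<longrightarrow> strongly_borel_cantelli_seq M B))"
proof -
  interpret S: stationary_sequence M X
    using assms(1-3) by (simp add: stationary_sequence.intro stationary_sequence_axioms.intro)
  note I = assms(5)
  have \<mu>: "measure \<mu> (I k) = S.marginal (I k)" if "k > 0" for k
  proof -
    have "measure (distr M borel (X 0)) (I k) = measure M (X 0 -` I k \<inter> space M)"
      using I[OF that] by (intro measure_distr real_interval_borel_measurable) auto
    then show ?thesis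
      unfolding assms(4) S.marginal_def by (simp add: vimage_def Int_def conj_commute)
  qed
  have \<mu>_Suc: "measure \<mu> (I (Suc k)) = S.marginal (I (Suc k))" for k by (rule \<mu>) simp
  have E: "E = (\<lambda>n. \<Sum>k=1..n. S.marginal (I k))"
    unfolding E_def by (intro ext sum.cong) (auto simp: \<mu>)
  have E_eq: "E n = (\<Sum>k=1..n. S.marginal (I k))" for n by (simp add: E)
  have pos: "0 < S.marginal (I 1)" using assms(6) \<mu>[of 1] by simp
  have div: "\<not> summable (\<lambda>k. S.marginal (I (Suc k)))" using assms(7) unfolding \<mu>_Suc .
  have mono: "antimono_on {1..} (\<lambda>n. S.marginal (I n))"
    if "antimono_on {1..} (\<lambda>n. measure \<mu> (I n))"
    using that unfolding monotone_on_def by (auto simp: \<mu>)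
  have E_pos: "0 < E n" if "0 < n" for n
  proof -
    have "S.marginal (I 1) \<le> E n"
      unfolding E using that by (intro member_le_sum) (auto simp: S.marginal_nonneg)
    with pos show ?thesis by simp
  qed

  have A: "borel_cantelli_seq M B"
    if h: "antimono \<alpha>s" "\<forall>n\<ge>n0. \<alpha> n \<le> C * \<alpha>s n \<and> \<alpha>s (2 * n) \<le> (1 - \<delta>) * \<alpha>s n"
      "0 < C" "0 < \<delta>" "antimono_on {1..} (\<lambda>n. measure \<mu> (I n))"
      and inf: "(\<Sum>k. let m = measure \<mu> (I (Suc k)) in
             if seq_inverse \<alpha>s m = 0 then 0
             else ennreal m / ennreal_of_enat (seq_inverse \<alpha>s m)) = \<infinity>"
    for \<alpha>s :: "nat \<Rightarrow> real" and n0 C \<delta>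
  proof -
    let ?t = "\<lambda>k. S.marginal (I (Suc k)) /
      real (LEAST l. 1 \<le> l \<and> \<alpha>s l \<le> S.marginal (I (Suc k)))"
    \<comment> \<open>The extended series in (A) is dominated termwise by \<open>?t\<close>, so
      summability of \<open>?t\<close> would make it finite.\<close>
    have "\<not> summable ?t"
    proof
      assume "summable ?t"
      then have "(\<Sum>k. ennreal (?t k)) \<noteq> \<infinity>"
        by (subst suminf_ennreal2) (auto simp: S.marginal_nonneg)
      moreover have "(\<Sum>k. if seq_inverse \<alpha>s (S.marginal (I (Suc k))) = 0 then 0
          else ennreal (S.marginal (I (Suc k))) /
            ennreal_of_enat (seq_inverse \<alpha>s (S.marginal (I (Suc k))))) \<le> (\<Sum>k. ennreal (?t k))"
        by (intro suminf_le summableI divide_seq_inverse_le S.marginal_nonneg)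
      then have "\<infinity> \<le> (\<Sum>k. ennreal (?t k))"
        using inf unfolding Let_def \<mu>_Suc by (simp only:)
      ultimately show False by (simp add: top_unique)
    qed
    moreover have "alpha_inf1 M X n \<le> C * \<alpha>s n \<and> \<alpha>s (2 * n) \<le> (1 - \<delta>) * \<alpha>s n" if "n0 \<le> n" for n
      using h(2) that unfolding \<alpha>_def by blast
    ultimately show ?thesis
      unfolding B_def
      by (intro S.borel_cantelli_of_halving_rate[where as = \<alpha>s and I = I,
          OF I div mono[OF h(5)] h(1) h(3) h(4)])
  qed

  have B1: "L1_borel_cantelli_seq M B"
    if "(\<lambda>n. pos_inverse (\<lambda>x. \<alpha> (nat \<lfloor>x\<rfloor>) / x) (1 / real n) / E n) \<longlonglongrightarrow> 0"
    unfolding B_def using that unfolding E \<alpha>_def by (intro S.L1_borel_cantelli_of_eta I div)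

  have B2: "strongly_borel_cantelli_seq M B"
    if u: "\<forall>n>0. u n > 0"
      "summable (\<lambda>k. let n = Suc k in measure \<mu> (I n) / E n * u n)"
      and fin: "(\<Sum>k. let n = Suc k in
              ennreal (measure \<mu> (I n) / (E n)\<^sup>2) *
              ennreal_of_enat (seq_inverse \<alpha> (E n * u n / real n))) < \<infinity>"
    for u :: "nat \<Rightarrow> real"
  proof -
    define s where "s n = seq_inverse \<alpha> (E n * u n / real n)" for n
    \<comment> \<open>Where \<open>s n\<close> is infinite, \<open>q n\<close> has no meaning; for
      \<open>n > 0\<close> this occurs only if the marginal is 0, and there the criterion asks for
      no mixing bound.\<close>
    define q where "q n = the_enat (s n)" for n
    let ?w = "\<lambda>n. S.marginal (I n) / (E n)\<^sup>2"
    let ?t = "\<lambda>k. ennreal (?w (Suc k)) * ennreal_of_enat (s (Suc k))"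
    have fin': "(\<Sum>k. ?t k) \<noteq> \<infinity>"
      using fin unfolding Let_def \<mu>_Suc s_def by simp
    have s_fin: "s n \<noteq> \<infinity>" if n: "0 < n" "0 < S.marginal (I n)" for n
    proof
      assume "s n = \<infinity>"
      obtain k where k: "n = Suc k" using n(1) by (cases n) auto
      have "?t k = \<infinity>" using n(2) E_pos[OF n(1)] \<open>s n = \<infinity>\<close> by (simp add: k ennreal_mult_top)
      moreover have "?t k \<le> (\<Sum>k. ?t k)"
        using sum_le_suminf[of ?t "{k}"] by simp
      ultimately show False using fin' by (simp add: top_unique)
    qed
    \<comment> \<open>If the marginal is 0, both sides vanish, using
      \<open>0 * \<infinity> = 0\<close> in the extended reals; otherwise \<open>s\<close> is
      finite.\<close>
    have t_eq: "?t k = ennreal (?w (Suc k) * real (q (Suc k)))" for k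
    proof (cases "S.marginal (I (Suc k)) = 0")
      case False
      then have "0 < S.marginal (I (Suc k))" using S.marginal_nonneg[of "I (Suc k)"] by simp
      then obtain j where "s (Suc k) = enat j" using s_fin[of "Suc k"] by auto
      then show ?thesis
        by (simp add: q_def ennreal_of_nat_eq_real_of_nat S.marginal_nonneg
            del: times_divide_eq_left flip: ennreal_mult'')
    qed simp
    show ?thesis
      unfolding B_def
    proof (rule S.strongly_borel_cantelli_of_lags[where q = q and u = u, OF I pos div],
        unfold E_eq[symmetric])
      show "summable (\<lambda>k. S.marginal (I (Suc k)) / E (Suc k) * u (Suc k))"
        using u(2) by (simp add: Let_def \<mu>_Suc)
      show "summable (\<lambda>k. ?w (Suc k) * real (q (Suc k)))"
        using fin' unfolding t_eq
        by (intro summable_suminf_not_top) (auto simp: S.marginal_nonneg infinity_ennreal_def)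
      show "alpha_inf1 M X (q n) \<le> E n * u n / real n" if "0 < n" "0 < S.marginal (I n)" for n
        using seq_inverse_attained s_fin[OF that] unfolding q_def s_def \<alpha>_def by blast
    qed (use u(1) in \<open>auto simp: less_imp_le\<close>)
  qed

  have C: "(\<not> summable (\<lambda>k. measure \<mu> (I (Suc k)) powr ((a + 1) / a)) \<and>
         filterlim (\<lambda>n. real n powr a * measure \<mu> (I n)) at_top sequentially \<and>
         antimono_on {1..} (\<lambda>n. measure \<mu> (I n))
           \<longrightarrow> borel_cantelli_seq M B)
        \<and>
        (filterlim (\<lambda>n. real n powr (- 1 / (a + 1)) * E n) at_top sequentially
           \<longrightarrow> L1_borel_cantelli_seq M B)
        \<and>
        (summable (\<lambda>k. let n = Suc k in real n powr (1 / (a + 1)) * measure \<mu> (I n) / (E n)\<^sup>2)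
           \<longrightarrow> strongly_borel_cantelli_seq M B)"
    if a: "0 < a" and rate: "\<forall>n\<ge>1. \<alpha> n \<le> C * real n powr (- a)" for a C
  proof -
    \<comment> \<open>The given constant may be non-positive, whereas the criteria require a
      positive one.\<close>
    define K where "K = max C 1"
    have K: "0 < K" by (simp add: K_def)
    have rate': "alpha_inf1 M X n \<le> K * real n powr (- a)" if "1 \<le> n" for n
    proof -
      have "\<alpha> n \<le> C * real n powr (- a)" using rate that by simp
      also have "\<dots> \<le> K * real n powr (- a)" by (intro mult_right_mono) (auto simp: K_def)
      finally show ?thesis by (simp add: \<alpha>_def)
    qed
    show ?thesis
      unfolding B_def \<mu>_Suc Let_def E
      by (intro conjI impI S.borel_cantelli_of_powr_rate[OF I a K div rate' mono]
          S.L1_borel_cantelli_of_powr_rate[OF I a K div rate']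
          S.strongly_borel_cantelli_of_powr_rate[OF I a K pos div rate']) auto
  qed

  show ?thesis
  proof (rule conjI[OF _ conjI[OF _ conjI]], goal_cases)
    case 1
    show ?case by (intro allI impI, elim conjE exE) (rule A; assumption)
  next
    case 2
    show ?case by (rule impI) (rule B1)
  next
    case 3
    show ?case by (rule impI, elim exE conjE) (rule B2; assumption)
  next
    case 4
    show ?case by (intro allI impI, elim exE) (rule C)
  qed
qed

end
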